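(* Let $q=p^n$ be an odd prime power ($p$ prime, $n\ge 1$), let $\chi$ be a generator of the cyclic group $\widehat{\mathbb{F}_q^{\times}}$ of multiplicative characters of $\mathbb{F}_q$, and let $1\le r\le q-2$ be an integer. For a divisor $1<k<q-1$ of $q-1$, let $a_1,\dots,a_{(q-1)/k}$ be the distinct elements of $D_k=\{x^k: x\in\mathbb{F}_q^{\times}\}$ (in any fixed order), and define the complex matrix $$B_{q,k}(\chi^r):=\left[\chi^r(a_i+a_j)+\chi^r(a_i-a_j)\right]_{1\le i,j\le (q-1)/k}.$$ Then: (i) If $q\equiv 3\pmod 4$, then $$\det (B_{q,2}(\chi^r))=\prod_{0\le k\le (q-3)/2}J_q(\chi^r,\chi^{2k})= \begin{cases} (-1)^{\frac{q-3}{4}}\,\mathbf{i}^n\,G_q(\chi^r)^{\frac{q-1}{2}}/\sqrt{q} & \text{if } r\equiv 1\pmod 2,\\ G_q(\chi^r)^{\frac{q-1}{2}}/q & \text{if } r\equiv 0\pmod 2. \end{cases}$$ (ii) For any divisor $1<k<q-1$ of $q-1$ with $(q-1)/k\equiv 0\pmod 2$, the matrix $B_{q,k}(\chi^r)$ is singular.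
   Context: Every multiplicative character $\psi$ of $\mathbb{F}_q$ is extended to $\mathbb{F}_q$ by $\psi(0)=0$ (including the trivial character). For characters $A,B$, the Jacobi sum is $J_q(A,B)=\sum_{x\in\mathbb{F}_q}A(x)B(1-x)$. The Gauss sum is $G_q(A)=\sum_{x\in\mathbb{F}_q}A(x)\zeta_p^{\mathrm{Tr}(x)}$, where $\zeta_p=e^{2\pi \mathbf{i}/p}$, $\mathbf{i}=e^{\pi\mathbf{i}/2}$ is the primitive fourth root of unity with argument $\pi/2$, and $\mathrm{Tr}(x)=\sum_{j=0}^{n-1}x^{p^j}$ is the trace from $\mathbb{F}_q$ to $\mathbb{F}_p$. Here $\sqrt{q}$ denotes the positive square root and $\chi^0$ is the trivial character. *)

theory Defs
  imports Complex_Main "Jordan_Normal_Form.Determinant"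
begin

definition mult_char :: "('a::{field,finite} \<Rightarrow> complex) \<Rightarrow> bool" where
  "mult_char \<psi> \<longleftrightarrow> \<psi> 0 = 0 \<and> (\<forall>x. x \<noteq> 0 \<longrightarrow> \<psi> x \<noteq> 0) \<and>
     (\<forall>x y. \<psi> (x * y) = \<psi> x * \<psi> y)"

(* the power chi^j as a character, with chi^j(0) = 0 (also for j = 0) *)
definition chpow :: "('a::{field,finite} \<Rightarrow> complex) \<Rightarrow> nat \<Rightarrow> 'a \<Rightarrow> complex" where
  "chpow \<chi> j x = (if x = 0 then 0 else \<chi> x ^ j)"

definition char_generator :: "('a::{field,finite} \<Rightarrow> complex) \<Rightarrow> bool" where
  "char_generator \<chi> \<longleftrightarrow> mult_char \<chi> \<and> (\<forall>\<psi>. mult_char \<psi> \<longrightarrow> (\<exists>j. \<psi> = chpow \<chi> j))"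

definition jacobi_sum :: "('a::{field,finite} \<Rightarrow> complex) \<Rightarrow> ('a \<Rightarrow> complex) \<Rightarrow> complex" where
  "jacobi_sum A B = (\<Sum>x\<in>UNIV. A x * B (1 - x))"

(* absolute trace F_q -> F_p, with F_p the prime subfield *)
definition field_trace :: "nat \<Rightarrow> nat \<Rightarrow> 'a::{field,finite} \<Rightarrow> 'a" where
  "field_trace p n x = (\<Sum>j<n. x ^ (p ^ j))"

definition trace_nat :: "nat \<Rightarrow> nat \<Rightarrow> 'a::{field,finite} \<Rightarrow> nat" where
  "trace_nat p n x = (THE m. m < p \<and> of_nat m = field_trace p n x)"

definition gauss_sum :: "nat \<Rightarrow> nat \<Rightarrow> ('a::{field,finite} \<Rightarrow> complex) \<Rightarrow> complex" where
  "gauss_sum p n A = (\<Sum>x\<in>UNIV. A x * exp (2 * of_real pi * \<i> * of_nat (trace_nat p n x) / of_nat p))"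

definition kth_powers :: "nat \<Rightarrow> 'a::{field,finite} set" where
  "kth_powers k = {x ^ k | x. x \<noteq> 0}"

(* B_{q,k}(psi) with rows/columns indexed along an enumeration as of D_k *)
definition Bmat :: "('a::{field,finite} \<Rightarrow> complex) \<Rightarrow> 'a list \<Rightarrow> complex mat" where
  "Bmat \<psi> as = mat (length as) (length as)
     (\<lambda>(i, j). \<psi> (as ! i + as ! j) + \<psi> (as ! i - as ! j))"

end

theory Submission
  imports Defs "HOL-Number_Theory.Residues"
begin

text \<open>
  If \<open>-1\<close> is a \<open>k\<close>-th power, then the columns of \<open>B\<close> belonging to \<open>1\<close> and \<open>-1\<close> coincide, which gives (ii).

  For \<open>q \<equiv> 3 (mod 4)\<close> the nonzero elements are the disjoint union of the squares \<open>D\<close> and of \<open>-D\<close>, so the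
  vector \<open>(\<chi>\<^sup>2\<^sup>m(d))\<close> is mapped by \<open>B\<close> to \<open>J(\<chi>\<^sup>r, \<chi>\<^sup>2\<^sup>m) \<chi>\<^sup>r(d) \<chi>\<^sup>2\<^sup>m(d)\<close>; as the product of all squares is \<open>1\<close>,
  the determinant is the product of these Jacobi sums. Writing them as quotients of Gauss sums, the product
  telescopes up to the quadratic Gauss sum, for which \<open>G = \<i>\<^sup>n \<surd>q\<close> is needed with its sign. That sum is
  \<open>\<Sum> e(Tr x\<^sup>2)\<close>, and in a basis orthonormal up to signs for the trace form it splits into \<open>n\<close> quadratic
  exponential sums over the prime field or their conjugates. The number of conjugates is even, because the
  discriminant of the basis is a square in \<open>F\<^sub>q\<close> and \<open>-1\<close> is not. The sum over the prime field is \<open>\<i>\<close> times a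
  positive number by Gauss's identity for alternating sums of \<open>q\<close>-binomial coefficients.
\<close>

hide_const (open) up_ring.monom up_ring.coeff

section \<open>Quadratic exponential sums modulo a prime\<close>

lemma cis_power_eq_1_iff:
  assumes "N > 0"
  shows "cis (2 * pi / real N) ^ k = 1 \<longleftrightarrow> N dvd k"
proof
  assume "cis (2 * pi / real N) ^ k = 1"
  then have "cos (2 * pi * (real k / real N)) = 1"
    by (auto simp: DeMoivre complex_eq_iff mult_ac)
  then obtain j :: int where "2 * pi * (real k / real N) = of_int j * 2 * pi"
    using cos_one_2pi_int by blast
  then have "(2 * pi) * (real k / real N) = (2 * pi) * of_int j"
    by (simp only: mult_ac)
  then have "real k / real N = of_int j"
    by (rule mult_left_cancel[THEN iffD1, rotated]) simp
  then have "real k = of_int j * real N" using assms by (simp add: field_simps)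
  then have "of_int (int k) = (of_int (j * int N) :: real)" by simp
  then have "int k = j * int N" by (simp only: of_int_eq_iff)
  then have "int N dvd int k" by simp
  then show "N dvd k" by (simp only: of_nat_dvd_iff)
next
  assume "N dvd k"
  then obtain m where k: "k = N * m" by blast
  have "cis (2 * pi / real N) ^ N = 1" using assms by (simp add: DeMoivre)
  then show "cis (2 * pi / real N) ^ k = 1" by (simp only: k power_mult power_one)
qed

section \<open>Gaussian binomial coefficients and Gauss's alternating sum of them\<close>

definition qbinom :: "complex \<Rightarrow> nat \<Rightarrow> nat \<Rightarrow> complex" where
  "qbinom x m j = (\<Prod>i<j. (1 - x ^ (m - i)) / (1 - x ^ Suc i))"

lemma qbinom_0 [simp]: "qbinom x m 0 = 1"
  by (simp add: qbinom_def)

text \<open>The factor with \<open>i = m\<close> has numerator \<open>1 - x ^ 0 = 0\<close>, so sums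
  over \<open>j\<close> may run past \<open>m\<close> without harm.\<close>

lemma qbinom_eq_0: "m < j \<Longrightarrow> qbinom x m j = 0"
  by (auto simp: qbinom_def intro!: bexI[of _ m])

text \<open>Both sides have the same denominator, and both numerators are the product of 1 -
  x^(m+1-i) over i <= j. Hence the identity holds for every \<open>x\<close>, even when some
  denominator vanishes.\<close>

lemma qbinom_Suc_left:
  "(1 - x ^ (Suc m - j)) * qbinom x (Suc m) j = (1 - x ^ Suc m) * qbinom x m j"
proof -
  have "(\<Prod>i<j. 1 - x ^ (Suc m - i)) * (1 - x ^ (Suc m - j)) = (\<Prod>i<Suc j. 1 - x ^ (Suc m - i))"
    by simp
  also have "\<dots> = (1 - x ^ Suc m) * (\<Prod>i<j. 1 - x ^ (m - i))"
    by (subst prod.lessThan_Suc_shift) simp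
  finally show ?thesis
    by (simp add: qbinom_def prod_dividef mult.commute)
qed

lemma qbinom_Suc_Suc:
  assumes "x ^ Suc j \<noteq> 1"
  shows "(1 - x ^ Suc j) * qbinom x (Suc m) (Suc j) = (1 - x ^ Suc m) * qbinom x m j"
proof -
  have "qbinom x (Suc m) (Suc j)
      = ((1 - x ^ Suc m) * (\<Prod>i<j. 1 - x ^ (m - i))) / ((\<Prod>i<j. 1 - x ^ Suc i) * (1 - x ^ Suc j))"
    unfolding qbinom_def prod_dividef
    by (subst prod.lessThan_Suc_shift, subst prod.lessThan_Suc) simp
  then show ?thesis
    using assms by (simp add: qbinom_def prod_dividef del: power_Suc)
qed

text \<open>The two absorption identities combine through (1 - x^(m-j)) + x^(m-j) (1 - x^(j+1)) = 1
  - x^(m+1), which is then cancelled.\<close>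

lemma qbinom_pascal:
  assumes "x ^ Suc m \<noteq> 1" "x ^ Suc j \<noteq> 1" "j \<le> m"
  shows "qbinom x (Suc m) (Suc j) = qbinom x m (Suc j) + x ^ (m - j) * qbinom x m j"
proof -
  have "(1 - x ^ Suc m) * (qbinom x m (Suc j) + x ^ (m - j) * qbinom x m j)
      = (1 - x ^ (Suc m - Suc j)) * qbinom x (Suc m) (Suc j)
        + x ^ (m - j) * ((1 - x ^ Suc j) * qbinom x (Suc m) (Suc j))"
    using qbinom_Suc_left[of x m "Suc j"] qbinom_Suc_Suc[OF assms(2), of m]
    by (simp add: distrib_left mult.left_commute del: power_Suc)
  also have "\<dots> = (1 - x ^ (m - j) * x ^ Suc j) * qbinom x (Suc m) (Suc j)"
    by (simp add: algebra_simps)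
  also have "x ^ (m - j) * x ^ Suc j = x ^ Suc m"
    using assms(3) by (simp flip: power_add del: power_Suc)
  finally show ?thesis
    using assms(1) by (simp del: power_Suc)
qed

text \<open>Pascal's rule splits level \<open>m + 2\<close> into two sums at level
  \<open>m + 1\<close>. Together they carry the weights 1 - x^(m+1-j), which
  \<open>qbinom_Suc_left\<close> trades for the single factor 1 - x^(m+1) at level
  \<open>m\<close>.\<close>

lemma alternating_qbinom_sum_step:
  assumes "\<And>i. 0 < i \<Longrightarrow> i \<le> m + 2 \<Longrightarrow> x ^ i \<noteq> 1"
  shows "(\<Sum>j\<le>m + 2. (-1) ^ j * qbinom x (m + 2) j)
       = (1 - x ^ Suc m) * (\<Sum>j\<le>m. (-1) ^ j * qbinom x m j)"
proof -
  let ?b = "qbinom x (Suc m)"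
  have "(\<Sum>j\<le>m + 2. (-1) ^ j * qbinom x (m + 2) j)
      = 1 + (\<Sum>j\<le>Suc m. (-1) ^ Suc j * qbinom x (Suc (Suc m)) (Suc j))"
    by (simp add: sum.atMost_Suc_shift del: sum.atMost_Suc)
  also have "\<dots> = 1 + (\<Sum>j\<le>Suc m. (-1) ^ Suc j * (?b (Suc j) + x ^ (Suc m - j) * ?b j))"
  proof (intro arg_cong[where f = "(+) 1"] sum.cong refl)
    fix j assume "j \<in> {..Suc m}"
    then show "(-1) ^ Suc j * qbinom x (Suc (Suc m)) (Suc j)
        = (-1) ^ Suc j * (?b (Suc j) + x ^ (Suc m - j) * ?b j)"
      by (subst qbinom_pascal) (use assms in \<open>auto simp del: power_Suc\<close>)
  qed
  also have "\<dots> = (1 + (\<Sum>j\<le>Suc m. (-1) ^ Suc j * ?b (Suc j)))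
      - (\<Sum>j\<le>Suc m. (-1) ^ j * x ^ (Suc m - j) * ?b j)"
    by (simp add: sum.distrib algebra_simps sum_subtractf sum_negf del: sum.atMost_Suc)
  also have "1 + (\<Sum>j\<le>Suc m. (-1) ^ Suc j * ?b (Suc j)) = (\<Sum>j\<le>Suc (Suc m). (-1) ^ j * ?b j)"
    by (simp add: sum.atMost_Suc_shift del: sum.atMost_Suc)
  also have "\<dots> = (\<Sum>j\<le>Suc m. (-1) ^ j * ?b j)"
    by (simp add: qbinom_eq_0)
  also have "\<dots> - (\<Sum>j\<le>Suc m. (-1) ^ j * x ^ (Suc m - j) * ?b j)
      = (\<Sum>j\<le>Suc m. (-1) ^ j * ((1 - x ^ (Suc m - j)) * ?b j))"
    by (simp add: sum_subtractf algebra_simps del: sum.atMost_Suc)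
  also have "\<dots> = (1 - x ^ Suc m) * (\<Sum>j\<le>Suc m. (-1) ^ j * qbinom x m j)"
    by (simp only: qbinom_Suc_left) (simp add: sum_distrib_left mult_ac del: sum.atMost_Suc)
  also have "(\<Sum>j\<le>Suc m. (-1) ^ j * qbinom x m j) = (\<Sum>j\<le>m. (-1) ^ j * qbinom x m j)"
    by (simp add: qbinom_eq_0)
  finally show ?thesis .
qed

lemma alternating_qbinom_sum:
  assumes "\<And>i. 0 < i \<Longrightarrow> i \<le> 2 * M \<Longrightarrow> x ^ i \<noteq> 1"
  shows "(\<Sum>j\<le>2 * M. (-1) ^ j * qbinom x (2 * M) j) = (\<Prod>k<M. 1 - x ^ (2 * k + 1))"
  using assms
proof (induction M)
  case (Suc M)
  have "(\<Sum>j\<le>2 * Suc M. (-1) ^ j * qbinom x (2 * Suc M) j)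
      = (1 - x ^ Suc (2 * M)) * (\<Sum>j\<le>2 * M. (-1) ^ j * qbinom x (2 * M) j)"
    using alternating_qbinom_sum_step[of "2 * M" x] Suc.prems by simp
  with Suc show ?case
    by (simp add: mult.commute)
qed simp

text \<open>For \<open>z\<close> of odd order 2M+1 the Gaussian binomials at x = z^(-2) are, up to
  sign, the powers z^(j(j+1)). Completing the square therefore turns the quadratic sum into Gauss's
  alternating sum, which is a product.\<close>

lemma sum_power_square_eq_prod:
  fixes z :: complex
  assumes z1: "z ^ (2 * M + 1) = 1" and prim: "\<And>i. 0 < i \<Longrightarrow> i \<le> 2 * M \<Longrightarrow> z ^ i \<noteq> 1"
  shows "(\<Sum>j<2 * M + 1. z ^ (j\<^sup>2)) = (\<Prod>k<M. z ^ (2 * k + 1) - inverse z ^ (2 * k + 1))"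
proof -
  have z0: "z \<noteq> 0" using z1 by auto
  have per: "z ^ i = z ^ j" if "[i = j] (mod (2 * M + 1))" for i j
  proof -
    have "z ^ i = z ^ (i mod (2 * M + 1))" for i
      by (subst mult_div_mod_eq[of "2 * M + 1" i, symmetric], subst power_add, subst power_mult)
        (simp only: z1 power_one mult_1)
    then show ?thesis using that by (metis cong_def)
  qed
  define x where "x = inverse z ^ 2"
  \<comment> \<open>The order of \<open>z\<close> is odd, so z^(2i) = 1 forces z^i = 1: the exponent
    2i(M+1) is congruent to i modulo 2M+1.\<close>
  have x_ne: "x ^ i \<noteq> 1" if i: "0 < i" "i \<le> 2 * M" for i
  proof
    assume "x ^ i = 1"
    then have zz: "z ^ (2 * i) = 1"
      by (simp add: x_def power_inverse flip: power_mult)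
    have "z ^ i = z ^ (i * (2 * M + 1) + i)"
      by (rule per) (simp only: cong_def mod_mult_self3)
    also have "i * (2 * M + 1) + i = (2 * i) * (M + 1)"
      by (simp add: algebra_simps)
    also have "z ^ \<dots> = 1"
      by (simp only: power_mult[of z "2 * i" "M + 1"] zz power_one)
    finally show False using prim i by blast
  qed
  have xp: "x ^ (2 * M + 1) = 1"
    using z1 by (simp only: x_def power_inverse power_mult[symmetric] mult.commute[of 2] power_mult) simp
  \<comment> \<open>Since x^(2M+1) = 1, the factor (1 - x^(2M-j)) / (1 - x^(j+1)) equals -x^(-(j+1))
    = -z^(2(j+1)), and these exponents add up to j(j+1).\<close>
  have q: "(-1) ^ j * qbinom x (2 * M) j = z ^ (j * (j + 1))" if "j \<le> 2 * M" for j
    using that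
  proof (induction j)
    case (Suc j)
    have "x ^ (2 * M - j) * x ^ Suc j = x ^ (2 * M + 1)"
      unfolding power_add[symmetric] using Suc.prems by (intro arg_cong[where f = "(^) x"]) simp
    then have "x ^ (2 * M - j) * x ^ Suc j = 1" using xp by (rule trans)
    then have "(1 - x ^ (2 * M - j)) * x ^ Suc j = - (1 - x ^ Suc j)"
      by (simp add: algebra_simps)
    moreover have "x \<noteq> 0" using z0 by (simp add: x_def)
    moreover have "a / (1 - u) = - inverse u" if "a * u = - (1 - u)" "u \<noteq> 0" "u \<noteq> 1" for a u :: complex
      using that by (simp add: divide_simps)
    ultimately have "(1 - x ^ (2 * M - j)) / (1 - x ^ Suc j) = - inverse (x ^ Suc j)"
      using x_ne[of "Suc j"] Suc.prems by simp
    also have "inverse (x ^ Suc j) = z ^ (2 * Suc j)"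
      by (simp add: x_def power_inverse flip: power_mult del: power_Suc)
    finally have "qbinom x (2 * M) (Suc j) = - (qbinom x (2 * M) j * z ^ (2 * Suc j))"
      by (simp add: qbinom_def del: power_Suc)
    then have "(-1) ^ Suc j * qbinom x (2 * M) (Suc j) = ((-1) ^ j * qbinom x (2 * M) j) * z ^ (2 * Suc j)"
      by simp
    also have "\<dots> = z ^ (j * (j + 1) + 2 * Suc j)"
      unfolding power_add using Suc.IH Suc.prems by simp
    also have "j * (j + 1) + 2 * Suc j = Suc j * (Suc j + 1)" by simp
    finally show ?case .
  qed simp
  \<comment> \<open>M+1 is the inverse of 2 modulo 2M+1, so translating by it completes the square;
    translating by M undoes it.\<close>
  have "(\<Sum>j<2 * M + 1. z ^ (j\<^sup>2)) = (\<Sum>j<2 * M + 1. z ^ ((j + (M + 1))\<^sup>2))"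
  proof (rule sum.reindex_bij_witness[of _ "\<lambda>j. (j + (M + 1)) mod (2 * M + 1)" "\<lambda>j. (j + M) mod (2 * M + 1)"])
    fix j assume "j \<in> {..<2 * M + 1}"
    then have j: "j < 2 * M + 1" by simp
    have shift: "(a mod (2 * M + 1) + b) mod (2 * M + 1) = j mod (2 * M + 1)"
      if "a + b = j + (2 * M + 1)" for a b
      by (simp only: mod_add_left_eq that mod_add_self2)
    have c: "[(j + M) mod (2 * M + 1) + (M + 1) = j] (mod (2 * M + 1))"
      "[(j + (M + 1)) mod (2 * M + 1) + M = j] (mod (2 * M + 1))"
      unfolding cong_def by (rule shift; simp)+
    from c j show "((j + M) mod (2 * M + 1) + (M + 1)) mod (2 * M + 1) = j"
      "((j + (M + 1)) mod (2 * M + 1) + M) mod (2 * M + 1) = j"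
      by (simp_all add: cong_def)
    show "z ^ (((j + M) mod (2 * M + 1) + (M + 1))\<^sup>2) = z ^ (j\<^sup>2)"
      by (rule per) (use c(1) in \<open>rule cong_pow\<close>)
  qed auto
  also have "\<dots> = (\<Sum>j\<le>2 * M. z ^ (M\<^sup>2) * z ^ (j * (j + 1)))"
  proof (rule sum.cong)
    fix j
    have "(j + (M + 1))\<^sup>2 = (j + 1) * (2 * M + 1) + (M\<^sup>2 + j * (j + 1))"
      by (simp add: power2_eq_square algebra_simps)
    then have "[(j + (M + 1))\<^sup>2 = M\<^sup>2 + j * (j + 1)] (mod (2 * M + 1))"
      by (simp only: cong_def mod_mult_self3)
    then show "z ^ ((j + (M + 1))\<^sup>2) = z ^ (M\<^sup>2) * z ^ (j * (j + 1))"
      by (metis per power_add)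
  qed auto
  also have "\<dots> = z ^ (M\<^sup>2) * (\<Sum>j\<le>2 * M. (-1) ^ j * qbinom x (2 * M) j)"
    by (simp add: sum_distrib_left q)
  also have "\<dots> = z ^ (M\<^sup>2) * (\<Prod>k<M. 1 - x ^ (2 * k + 1))"
    using alternating_qbinom_sum[of M x] x_ne by simp
  \<comment> \<open>M^2 is the sum of the first M odd numbers. One power z^(2k+1) goes into each
    factor and makes it antisymmetric under inversion of \<open>z\<close>.\<close>
  also have "z ^ (M\<^sup>2) = (\<Prod>k<M. z ^ (2 * k + 1))"
  proof (induction M)
    case (Suc M)
    have "(Suc M)\<^sup>2 = M\<^sup>2 + (2 * M + 1)" by (simp add: power2_eq_square)
    then show ?case by (simp only: power_add Suc.IH prod.lessThan_Suc)
  qed simp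
  also have "\<dots> * (\<Prod>k<M. 1 - x ^ (2 * k + 1)) = (\<Prod>k<M. z ^ (2 * k + 1) * (1 - x ^ (2 * k + 1)))"
    by (simp add: prod.distrib)
  also have "\<dots> = (\<Prod>k<M. z ^ (2 * k + 1) - inverse z ^ (2 * k + 1))"
  proof (rule prod.cong)
    fix k
    have "x ^ (2 * k + 1) = inverse z ^ (2 * k + 1) * inverse z ^ (2 * k + 1)"
      by (simp only: x_def power_mult[symmetric] power_add[symmetric] mult_2)
    then show "z ^ (2 * k + 1) * (1 - x ^ (2 * k + 1)) = z ^ (2 * k + 1) - inverse z ^ (2 * k + 1)"
      using z0 by (simp add: field_simps)
  qed simp
  finally show ?thesis .
qed

text \<open>Write p = 4t+3. The factors are 2 \<i> sin(2 pi (2k+1)/p) for k < 2t+1; the first t+1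
  sines are positive and the last t negative, so the phase is \<i>^(2t+1) (-1)^t = \<i>. The modulus
  is left open and comes later from the square of the Gauss sum.\<close>

lemma quadratic_exponential_sum:
  assumes p: "p mod 4 = 3"
  shows "\<exists>\<rho>>0. (\<Sum>j<p. cis (2 * pi / real p) ^ (j\<^sup>2)) = \<i> * complex_of_real \<rho>"
proof -
  define t where "t = p div 4"
  define M where "M = 2 * t + 1"
  have pM: "p = 2 * M + 1" "p = 4 * t + 3"
    using p unfolding M_def t_def by presburger+
  define z where "z = cis (2 * pi / real p)"
  have p0: "p > 0" using pM by simp
  have z1: "z ^ p = 1"
    using p0 by (simp add: z_def cis_power_eq_1_iff)
  have prim: "z ^ i \<noteq> 1" if "0 < i" "i \<le> 2 * M" for i
    using that pM cis_power_eq_1_iff[of p i] p0 by (auto simp: z_def dest!: dvd_imp_le)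
  define s where "s k = sin (2 * pi * real (2 * k + 1) / real p)" for k
  have "(\<Sum>j<p. z ^ (j\<^sup>2)) = (\<Prod>k<M. z ^ (2 * k + 1) - inverse z ^ (2 * k + 1))"
    using sum_power_square_eq_prod[of z M] z1 prim pM(1) by simp
  also have "\<dots> = (\<Prod>k<M. (2 * \<i>) * of_real (s k))"
  proof (rule prod.cong)
    fix k
    have "z ^ (2 * k + 1) = cis (2 * pi * real (2 * k + 1) / real p)"
      by (simp only: z_def DeMoivre) (simp add: mult_ac)
    moreover have "inverse z ^ (2 * k + 1) = cis (- (2 * pi * real (2 * k + 1) / real p))"
      by (simp only: power_inverse z_def DeMoivre cis_inverse) (simp add: mult_ac)
    ultimately show "z ^ (2 * k + 1) - inverse z ^ (2 * k + 1) = (2 * \<i>) * of_real (s k)"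
      by (simp only: complex_eq_iff) (simp add: s_def)
  qed simp
  also have "\<dots> = (2 * \<i>) ^ M * of_real (\<Prod>k<M. s k)"
    by (simp add: prod.distrib)
  also have "{..<M} = {..<t + 1} \<union> {t + 1..<M}"
    by (auto simp: M_def)
  also have "(\<Prod>k\<in>\<dots>. s k) = (\<Prod>k<t + 1. s k) * (\<Prod>k=t + 1..<M. s k)"
    by (rule prod.union_disjoint) auto
  also have "(\<Prod>k=t + 1..<M. s k) = (-1) ^ t * (\<Prod>k=t + 1..<M. - s k)"
    by (cases "even t") (simp_all add: prod_uminus M_def)
  also have "(2 * \<i>) ^ M * complex_of_real ((\<Prod>k<t + 1. s k) * ((-1) ^ t * (\<Prod>k=t + 1..<M. - s k)))
      = \<i> * complex_of_real (2 ^ M * (\<Prod>k<t + 1. s k) * (\<Prod>k=t + 1..<M. - s k))"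
  proof -
    have "\<i> ^ M * (-1) ^ t = \<i>"
      by (cases "even t") (simp_all add: M_def power_mult)
    moreover have "(2 * \<i>) ^ M * complex_of_real (a * ((-1) ^ t * b))
        = (\<i> ^ M * (-1) ^ t) * complex_of_real (2 ^ M * a * b)" for a b
      by (simp add: power_mult_distrib)
    ultimately show ?thesis by simp
  qed
  finally have eq: "(\<Sum>j<p. z ^ (j\<^sup>2))
      = \<i> * complex_of_real (2 ^ M * (\<Prod>k<t + 1. s k) * (\<Prod>k=t + 1..<M. - s k))" .
  have "s k > 0" if "k < t + 1" for k
  proof -
    have "real (2 * k + 1) / real p < 1 / 2"
      using that pM by (simp add: field_simps)
    then have "2 * pi * (real (2 * k + 1) / real p) < 2 * pi * (1 / 2)"
      by (intro mult_strict_left_mono) auto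
    then show ?thesis unfolding s_def by (intro sin_gt_zero) (use p0 in auto)
  qed
  moreover have "- s k > 0" if "k \<in> {t + 1..<M}" for k
  proof -
    have "1 / 2 < real (2 * k + 1) / real p" "real (2 * k + 1) / real p < 1"
      using that pM by (simp_all add: field_simps M_def)
    then have "2 * pi * (1 / 2) < 2 * pi * (real (2 * k + 1) / real p)"
        "2 * pi * (real (2 * k + 1) / real p) < 2 * pi * 1"
      by (intro mult_strict_left_mono; simp)+
    then have "sin (2 * pi * (real (2 * k + 1) / real p)) < 0"
      by (intro sin_lt_zero) auto
    then show ?thesis unfolding s_def by simp
  qed
  ultimately have "2 ^ M * (\<Prod>k<t + 1. s k) * (\<Prod>k=t + 1..<M. - s k) > 0"
    by (intro mult_pos_pos prod_pos) auto
  with eq show ?thesis unfolding z_def by blast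
qed

section \<open>Trace and additive characters\<close>

lemma nonzero_power_card_minus_1:
  fixes x :: "'a::{field,finite}"
  assumes "x \<noteq> 0"
  shows "x ^ (card (UNIV :: 'a set) - 1) = 1"
proof -
  have "(\<Prod>y\<in>UNIV-{0}. x * y) = (\<Prod>y\<in>UNIV-{0}. y)"
    by (rule prod.reindex_bij_witness[of _ "\<lambda>y. y / x" "\<lambda>y. x * y"]) (use assms in auto)
  moreover have "(\<Prod>y\<in>UNIV-{0}. x * y) = x ^ (card (UNIV :: 'a set) - 1) * \<Prod>(UNIV-{0})"
    by (simp add: prod.distrib)
  ultimately show ?thesis by simp
qed

lemma power_card_eq_same:
  fixes x :: "'a::{field,finite}"
  shows "x ^ card (UNIV :: 'a set) = x"
proof (cases "x = 0")
  case False
  have "x ^ card (UNIV :: 'a set) = x ^ Suc (card (UNIV :: 'a set) - 1)"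
    using finite_UNIV_card_ge_0[where ?'a = 'a] by simp
  then show ?thesis using nonzero_power_card_minus_1[OF False] by simp
qed (use finite_UNIV_card_ge_0[where ?'a = 'a] in auto)

text \<open>The field type is repackaged as a ring record, so that cyclicity of the unit group can
  be taken from \<open>finite_field_mult_group_has_gen\<close>.\<close>

lemma multiplicative_generator:
  "\<exists>g :: 'a::{field,finite}. g \<noteq> 0 \<and> (\<forall>x. x \<noteq> 0 \<longrightarrow> (\<exists>k. x = g ^ k))"
proof -
  let ?R = "\<lparr>carrier = UNIV, mult = (*), one = 1, zero = 0, add = (+)\<rparr> :: 'a ring"
  have "abelian_group ?R"
    by (unfold_locales) (auto simp: Units_def intro!: exI[of _ "- x" for x] simp: algebra_simps)
  then interpret R: abelian_group ?R .
  have inv: "\<exists>y. y * x = 1 \<and> x * y = 1" if "x \<noteq> 0" for x :: 'a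
    by (rule exI[of _ "inverse x"]) (use that in auto)
  interpret R: field ?R
    by unfold_locales (use inv in \<open>auto simp: algebra_simps Units_def\<close>)
  have pow: "x [^]\<^bsub>?R\<^esub> i = x ^ i" for x :: 'a and i :: nat
    by (induction i) auto
  obtain g where "g \<in> carrier (mult_of ?R)"
      "carrier (mult_of ?R) = {g [^]\<^bsub>?R\<^esub> i | i::nat. i \<in> UNIV}"
    using R.finite_field_mult_group_has_gen by (auto simp: nat_pow_mult_of)
  then have "g \<noteq> 0" "UNIV - {0} = {g ^ i | i :: nat. i \<in> UNIV}"
    by (auto simp: pow carrier_mult_of)
  then show ?thesis by blast
qed

text \<open>The parameter \<open>F\<close> only pins the type of the field.\<close>

locale prime_power_field =
  fixes F :: "'a::{field,finite} itself" and p n q :: nat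
  assumes prime_p: "prime p" and q_eq: "q = p ^ n" and card_q: "card (UNIV :: 'a set) = q"
begin

lemmas card_UNIV = card_q[unfolded q_eq]

abbreviation Tr :: "'a \<Rightarrow> 'a" where "Tr \<equiv> field_trace p n"

lemma p_pos: "p > 0"
  using prime_p prime_gt_0_nat by blast

lemma n_pos: "n > 0"
proof (rule ccontr)
  assume "\<not> n > 0"
  then have "card (UNIV :: 'a set) = 1" using card_UNIV by simp
  then have "(0 :: 'a) = 1" by (metis UNIV_I card_1_singletonE singletonD)
  then show False by simp
qed

lemma CHAR_eq: "CHAR('a) = p"
proof -
  have "prime CHAR('a)"
    using finite_imp_CHAR_pos[where ?'a = 'a] prime_CHAR_semidom[where ?'a = 'a] by simp
  moreover have "CHAR('a) dvd p ^ n"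
    using CHAR_dvd_CARD[where ?'a = 'a] card_UNIV by simp
  ultimately show ?thesis
    using prime_p by (metis prime_dvd_power primes_dvd_imp_eq)
qed

lemma frobenius_add: "(x + y :: 'a) ^ (p ^ j) = x ^ (p ^ j) + y ^ (p ^ j)"
  by (rule freshmans_dream') (use prime_p CHAR_eq in auto)

lemma trace_add: "Tr (x + y) = Tr x + Tr y"
  by (simp add: field_trace_def frobenius_add sum.distrib)

lemma trace_0 [simp]: "Tr 0 = 0"
  using trace_add[of 0 0] by (metis add_0 add_cancel_right_left)

lemma trace_diff: "Tr (x - y) = Tr x - Tr y"
  using trace_add[of "x - y" y] by (simp add: algebra_simps)

lemma trace_sum: "Tr (\<Sum>i\<in>A. f i) = (\<Sum>i\<in>A. Tr (f i))"
  by (induction A rule: infinite_finite_induct) (auto simp: trace_add)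

section \<open>The prime subfield and the values of the trace\<close>

definition prime_subfield :: "'a set" where
  "prime_subfield = of_nat ` {..<p}"

lemma of_nat_power_p: "(of_nat m :: 'a) ^ p = of_nat m"
proof (induction m)
  case (Suc m)
  then show ?case using frobenius_add[of 1 "of_nat m" 1] by simp
qed (use p_pos in auto)

lemma of_nat_in_prime_subfield [simp]: "of_nat m \<in> prime_subfield"
proof -
  have "(of_nat m :: 'a) = of_nat (m mod p)"
    by (metis CHAR_eq cong_def mod_mod_trivial of_nat_eq_iff_cong_CHAR)
  then show ?thesis using p_pos by (auto simp: prime_subfield_def)
qed

lemma inj_on_of_nat: "inj_on (of_nat :: nat \<Rightarrow> 'a) {..<p}"
  by (auto simp: inj_on_def of_nat_eq_iff_cong_CHAR CHAR_eq cong_def)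

lemma card_prime_subfield: "card prime_subfield = p"
  by (simp add: prime_subfield_def card_image inj_on_of_nat)

text \<open>X^p - X has at most p roots, and the p elements of \<open>prime_subfield\<close> are
  already roots.\<close>

lemma prime_subfield_iff: "x \<in> prime_subfield \<longleftrightarrow> x ^ p = x"
proof -
  let ?f = "monom 1 p - monom 1 1 :: 'a poly"
  have p1: "p > 1" using prime_p prime_gt_1_nat by blast
  have "coeff ?f p = 1" using p1 by simp
  then have f0: "?f \<noteq> 0" by (metis Polynomial.coeff_0 zero_neq_one)
  have "degree ?f \<le> p"
    by (rule degree_diff_le) (use p1 in \<open>auto simp: degree_monom_eq\<close>)
  then have "card {x. poly ?f x = 0} \<le> p"
    using card_poly_roots_bound[OF f0] by linarith
  moreover have "{x. poly ?f x = 0} = {x. x ^ p = x}"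
    by (auto simp: poly_monom)
  ultimately have "card {x :: 'a. x ^ p = x} \<le> card prime_subfield"
    by (simp add: card_prime_subfield)
  moreover have "prime_subfield \<subseteq> {x. x ^ p = x}"
    by (auto simp: prime_subfield_def of_nat_power_p)
  ultimately have "prime_subfield = {x. x ^ p = x}"
    by (intro card_seteq) auto
  then show ?thesis by blast
qed

lemma prime_subfield_mult: "x \<in> prime_subfield \<Longrightarrow> y \<in> prime_subfield \<Longrightarrow> x * y \<in> prime_subfield"
  by (simp add: prime_subfield_iff power_mult_distrib)

lemma prime_subfield_power: "x \<in> prime_subfield \<Longrightarrow> x ^ k \<in> prime_subfield"
  by (simp add: prime_subfield_iff flip: power_mult) (simp add: power_mult mult.commute[of k])

lemma prime_subfield_inverse: "x \<in> prime_subfield \<Longrightarrow> inverse x \<in> prime_subfield"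
  by (simp add: prime_subfield_iff power_inverse)

text \<open>Frobenius shifts the summands of the trace by one place, and x^(p^n) = x closes the
  cycle.\<close>

lemma trace_in_prime_subfield [simp]: "Tr x \<in> prime_subfield"
proof -
  have "Tr x ^ p = (\<Sum>j<n. (x ^ p ^ j) ^ p)"
    unfolding field_trace_def
    by (rule freshmans_dream_sum) (use prime_p CHAR_eq in auto)
  also have "\<dots> = (\<Sum>j<n. x ^ p ^ Suc j)"
    by (simp add: mult.commute flip: power_mult)
  also have "\<dots> = (\<Sum>j<Suc n. x ^ p ^ j) - x"
    by (subst sum.lessThan_Suc_shift) simp
  also have "\<dots> = Tr x"
    using power_card_eq_same[of x] by (simp add: field_trace_def card_UNIV)
  finally show ?thesis by (simp add: prime_subfield_iff)
qed

lemma trace_scale: "c \<in> prime_subfield \<Longrightarrow> Tr (c * x) = c * Tr x"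
proof -
  assume "c \<in> prime_subfield"
  then have "c ^ (p ^ j) = c" for j
    by (induction j) (auto simp: prime_subfield_iff power_mult)
  then show ?thesis by (simp add: field_trace_def power_mult_distrib sum_distrib_left)
qed

text \<open>The trace is a nonzero polynomial of degree at most p^(n-1), which has too few roots to
  vanish on p^n elements.\<close>

lemma trace_not_identically_0: "\<exists>x. Tr x \<noteq> 0"
proof (rule ccontr)
  assume "\<not> ?thesis"
  then have all: "Tr x = 0" for x by blast
  let ?f = "(\<Sum>j<n. monom 1 (p ^ j)) :: 'a poly"
  have p1: "p > 1" using prime_p prime_gt_1_nat by blast
  have "coeff ?f (p ^ (n - 1)) = (\<Sum>j<n. if j = n - 1 then 1 else 0)"
    unfolding Polynomial.coeff_sum Polynomial.coeff_monom
    by (intro sum.cong refl) (use p1 in \<open>auto dest: power_inject_exp[THEN iffD1, rotated]\<close>)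
  then have "coeff ?f (p ^ (n - 1)) = 1" using n_pos by simp
  then have f0: "?f \<noteq> 0" by (metis Polynomial.coeff_0 zero_neq_one)
  have "degree ?f \<le> p ^ (n - 1)"
    by (rule degree_sum_le) (use p1 in \<open>auto simp: degree_monom_eq intro!: power_increasing\<close>)
  moreover have "{x. poly ?f x = 0} = UNIV"
    using all by (auto simp: poly_sum poly_monom field_trace_def)
  ultimately have "p ^ n \<le> p ^ (n - 1)"
    using card_poly_roots_bound[OF f0] card_UNIV by simp
  then show False using p1 n_pos by (simp add: power_increasing_iff)
qed

lemma trace_form_nondegenerate:
  assumes "\<And>z. Tr (y * z) = 0"
  shows "y = 0"
proof (rule ccontr)
  assume "y \<noteq> 0"
  then have "Tr x = 0" for x using assms[of "x / y"] by simp
  then show False using trace_not_identically_0 by blast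
qed

section \<open>The additive character attached to the trace\<close>

definition add_char :: "'a \<Rightarrow> complex" where
  "add_char x = exp (2 * of_real pi * \<i> * of_nat (trace_nat p n x) / of_nat p)"

lemma gauss_sum_add_char: "gauss_sum p n A = (\<Sum>x\<in>UNIV. A x * add_char x)"
  by (simp add: gauss_sum_def add_char_def)

lemma root_of_unity_power_p: "cis (2 * pi / real p) ^ p = 1"
  using p_pos by (simp add: cis_power_eq_1_iff)

text \<open>Replaces the definite description in \<open>trace_nat\<close> by any natural number
  representing the trace, since exponents matter only modulo \<open>p\<close>. Additivity of the
  character follows from this.\<close>

lemma add_char_eq:
  assumes "Tr x = of_nat m"
  shows "add_char x = cis (2 * pi / real p) ^ m"
proof -
  define k where "k = trace_nat p n x"
  have "\<exists>m<p. of_nat m = Tr x"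
    using trace_in_prime_subfield[of x] by (auto simp: prime_subfield_def)
  then have "\<exists>!m. m < p \<and> of_nat m = Tr x"
    using inj_on_of_nat by (auto simp: inj_on_def)
  from theI'[OF this] have k: "k < p" "of_nat k = Tr x"
    by (auto simp: k_def trace_nat_def)
  then have "[k = m] (mod p)"
    using assms of_nat_eq_iff_cong_CHAR[where ?'a = 'a] CHAR_eq by metis
  moreover have "cis (2 * pi / real p) ^ j = cis (2 * pi / real p) ^ (j mod p)" for j
    by (subst mult_div_mod_eq[of p j, symmetric], subst power_add, subst power_mult)
      (simp only: root_of_unity_power_p power_one mult_1)
  ultimately have "cis (2 * pi / real p) ^ k = cis (2 * pi / real p) ^ m"
    by (metis cong_def)
  moreover have "add_char x = cis (2 * pi / real p) ^ k"
    unfolding DeMoivre by (simp add: add_char_def k_def[symmetric] cis_conv_exp mult_ac)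
  ultimately show ?thesis by simp
qed

lemma add_char_add: "add_char (x + y) = add_char x * add_char y"
proof -
  obtain k m where km: "Tr x = of_nat k" "Tr y = of_nat m"
    using trace_in_prime_subfield[of x] trace_in_prime_subfield[of y]
    by (auto simp: prime_subfield_def)
  then have "Tr (x + y) = of_nat (k + m)" by (simp add: trace_add)
  with km show ?thesis by (simp only: add_char_eq power_add)
qed

lemma add_char_0 [simp]: "add_char 0 = 1"
  using add_char_eq[of 0 0] by simp

lemma add_char_sum: "add_char (\<Sum>i\<in>A. f i) = (\<Prod>i\<in>A. add_char (f i))"
  by (induction A rule: infinite_finite_induct) (auto simp: add_char_add)

lemma sum_add_char: "(\<Sum>x\<in>UNIV. add_char x) = 0"
proof -
  \<comment> \<open>Rescaling inside the prime subfield gives an element of trace 1. Translating by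
    it multiplies the sum by a primitive p-th root of unity, so the sum vanishes.\<close>
  obtain y0 where y0: "Tr y0 \<noteq> 0" using trace_not_identically_0 by blast
  define y where "y = inverse (Tr y0) * y0"
  have "Tr y = 1"
    using y0 by (simp add: y_def trace_scale prime_subfield_inverse)
  then have ey: "add_char y = cis (2 * pi / real p)" using add_char_eq[of y 1] by simp
  have p1: "p > 1" using prime_p prime_gt_1_nat by blast
  have "add_char y \<noteq> 1"
    using ey p1 cis_power_eq_1_iff[of p 1] by simp
  moreover have "(\<Sum>x\<in>UNIV. add_char x) = (\<Sum>x\<in>UNIV. add_char (x + y))"
    by (rule sum.reindex_bij_witness[of _ "\<lambda>x. x + y" "\<lambda>x. x - y"]) auto
  then have "(\<Sum>x\<in>UNIV. add_char x) = (\<Sum>x\<in>UNIV. add_char x) * add_char y"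
    unfolding sum_distrib_right add_char_add .
  ultimately show ?thesis by simp
qed

end

section \<open>Orthonormal bases for the trace form\<close>

text \<open>For y = x^((N+1)/4) one has y^4 = x^(N+1) = x^2. Applied with N = p in the prime
  subfield and with N = q in the whole field.\<close>

lemma square_or_minus_square:
  fixes x :: "'a::field"
  assumes "N mod 4 = 3" "x ^ N = x" "x \<noteq> 0"
  shows "(x ^ ((N + 1) div 4))\<^sup>2 = x \<or> (x ^ ((N + 1) div 4))\<^sup>2 = - x"
proof -
  define t where "t = N div 4"
  have N: "N = 4 * t + 3" "(N + 1) div 4 = t + 1" using assms(1) unfolding t_def by presburger+
  have "((x ^ (t + 1))\<^sup>2)\<^sup>2 = x ^ Suc N"
    unfolding power_mult[symmetric] by (rule arg_cong[where f = "(^) x"]) (simp add: N(1))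
  then have "((x ^ (t + 1))\<^sup>2)\<^sup>2 = x\<^sup>2"
    by (simp add: assms(2) power2_eq_square)
  then show ?thesis by (simp only: N(2) power2_eq_iff)
qed

context prime_power_field
begin

text \<open>Norms can be normalised only up to sign, as -1 is not a square when p is 3 modulo 4. The
  signs are integers so that they can appear both in the finite field and as complex
  factors.\<close>

definition orthonormal :: "nat \<Rightarrow> (nat \<Rightarrow> 'a) \<Rightarrow> (nat \<Rightarrow> int) \<Rightarrow> bool" where
  "orthonormal l b s \<longleftrightarrow> (\<forall>i<l. \<bar>s i\<bar> = 1) \<and>
     (\<forall>i<l. \<forall>j<l. Tr (b i * b j) = (if i = j then of_int (s i) else 0))"

lemma orthonormal_coefficient:
  assumes "orthonormal l b s" "\<And>j. j < l \<Longrightarrow> c j \<in> prime_subfield" "i < l"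
  shows "Tr ((\<Sum>j<l. c j * b j) * b i) = c i * of_int (s i)"
proof -
  have "Tr ((\<Sum>j<l. c j * b j) * b i) = (\<Sum>j<l. Tr (c j * (b j * b i)))"
    by (simp add: sum_distrib_right trace_sum mult.assoc)
  also have "\<dots> = (\<Sum>j<l. if j = i then c i * of_int (s i) else 0)"
    by (rule sum.cong) (use assms in \<open>auto simp: trace_scale orthonormal_def\<close>)
  finally show ?thesis using assms(3) by simp
qed

text \<open>Coordinates are kept as natural numbers below \<open>p\<close> because they turn into
  exponents of a root of unity; extensionality makes the parametrisation injective.\<close>

abbreviation coefficient_vectors :: "nat \<Rightarrow> (nat \<Rightarrow> nat) set" where
  "coefficient_vectors l \<equiv> PiE {..<l} (\<lambda>_. {..<p})"

text \<open>Pairing with \<open>b i\<close> under the trace form recovers the i-th coordinate up to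
  the sign \<open>s i\<close>.\<close>

lemma inj_on_linear_combination:
  assumes "orthonormal l b s"
  shows "inj_on (\<lambda>c. \<Sum>j<l. of_nat (c j) * b j) (coefficient_vectors l)"
proof (rule inj_onI)
  fix c d assume c: "c \<in> coefficient_vectors l" and d: "d \<in> coefficient_vectors l"
    and eq: "(\<Sum>j<l. of_nat (c j) * b j) = (\<Sum>j<l. of_nat (d j) * b j)"
  have "c i = d i" if i: "i < l" for i
  proof -
    have "(of_nat (c i) :: 'a) * of_int (s i) = of_nat (d i) * of_int (s i)"
    proof -
      have "Tr ((\<Sum>j<l. of_nat (e j) * b j) * b i) = of_nat (e i) * of_int (s i)" for e :: "nat \<Rightarrow> nat"
        by (rule orthonormal_coefficient[OF assms _ i]) simp
      then show ?thesis using eq by metis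
    qed
    moreover have "s i = 1 \<or> s i = -1" using assms i by (auto simp: orthonormal_def)
    ultimately have "(of_nat (c i) :: 'a) = of_nat (d i)" by auto
    then show ?thesis using inj_on_of_nat c d i by (auto simp: inj_on_def PiE_iff)
  qed
  then show "c = d" using c d by (intro PiE_ext[of c _ _ d]) auto
qed

lemma orthonormal_length_le:
  assumes "orthonormal l b s"
  shows "l \<le> n"
proof -
  have "card (coefficient_vectors l) \<le> card (UNIV :: 'a set)"
    by (rule card_inj_on_le[OF inj_on_linear_combination[OF assms]]) auto
  then have "p ^ l \<le> p ^ n" by (simp add: card_PiE card_UNIV)
  then show ?thesis using prime_p prime_gt_1_nat by (simp add: power_increasing_iff)
qed

lemma minus_1_neq_1:
  assumes "odd q"
  shows "(-1 :: 'a) \<noteq> 1"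
proof
  assume "(-1 :: 'a) = 1"
  then have "(of_nat 2 :: 'a) = 0" by (metis add.right_inverse of_nat_numeral one_add_one)
  then have "p dvd 2" using CHAR_eq of_nat_eq_0_iff_char_dvd by metis
  then have "p = 2" using prime_p by (metis prime_ge_2_nat dvd_imp_le le_antisym zero_less_numeral)
  then show False using assms q_eq n_pos by simp
qed

text \<open>Modulo 4, powers of 1 and even powers of 3 are 1.\<close>

lemma p_mod_4:
  assumes "q mod 4 = 3"
  shows "p mod 4 = 3" and "odd n"
proof -
  have "odd q" using assms by presburger
  then have "odd p" using q_eq n_pos by simp
  then have p: "p mod 4 = 1 \<or> p mod 4 = 3" by presburger
  have q: "q mod 4 = (p mod 4) ^ n mod 4" by (simp add: q_eq power_mod)
  show p3: "p mod 4 = 3"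
    using p q assms by auto
  show "odd n"
  proof
    assume "even n"
    then obtain k where "n = 2 * k" by blast
    then have "q mod 4 = ((p mod 4)\<^sup>2) ^ k mod 4" using q by (simp only: power_mult)
    also have "\<dots> = 1" using power_mod[of 9 "4 :: nat" k] by (simp add: p3)
    finally show False using assms by simp
  qed
qed

text \<open>(q-1)/2 is odd, so raising y^2 = -1 to this power would give y^(q-1) = -1.\<close>

lemma minus_1_not_square:
  assumes "q mod 4 = 3"
  shows "y\<^sup>2 \<noteq> (-1 :: 'a)"
proof
  assume y: "y\<^sup>2 = -1"
  then have "y \<noteq> 0" by auto
  then have "y ^ (q - 1) = 1" by (metis nonzero_power_card_minus_1 card_q)
  moreover obtain t where "q = 4 * t + 3"
    using assms by (metis mult_div_mod_eq)
  then have "q - 1 = 2 * (2 * t + 1)" by simp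
  then have "y ^ (q - 1) = (-1) ^ (2 * t + 1)" by (simp only: power_mult y)
  ultimately have "(-1 :: 'a) = 1" by simp
  moreover have "odd q" using assms by presburger
  ultimately show False using minus_1_neq_1 by blast
qed

text \<open>Starts from an orthonormal family of maximal length. A vector orthogonal to it is
  isotropic, since otherwise a multiple of it would extend the family. By polarisation the form
  vanishes on the orthogonal complement, which is then zero by nondegeneracy; counting gives length
  \<open>n\<close>.\<close>

lemma ex_complete_orthonormal:
  assumes q: "q mod 4 = 3"
  obtains b s where "orthonormal n b s" "bij_betw (\<lambda>c. \<Sum>j<n. of_nat (c j) * b j) (coefficient_vectors n) UNIV"
proof -
  have two: "(2 :: 'a) \<noteq> 0"
  proof
    assume "(2 :: 'a) = 0"
    then have "(-1 :: 'a) = 1" by (metis add_eq_0_iff one_add_one)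
    moreover have "odd q" using q by presburger
    ultimately show False using minus_1_neq_1 by blast
  qed
  define l where "l = (GREATEST l. \<exists>b s. orthonormal l b s)"
  have ex0: "\<exists>b s. orthonormal 0 b s" by (simp add: orthonormal_def)
  have bound: "\<forall>l. (\<exists>b s. orthonormal l b s) \<longrightarrow> l \<le> n" using orthonormal_length_le by blast
  obtain b s where bs: "orthonormal l b s"
    unfolding l_def using GreatestI_nat[of "\<lambda>l. \<exists>b s. orthonormal l b s", OF ex0] bound by blast
  have max: "\<not> orthonormal (Suc l) b' s'" for b' s'
    unfolding l_def using Greatest_le_nat[of "\<lambda>l. \<exists>b s. orthonormal l b s" _ n] bound
    by (metis Suc_n_not_le_n)
  have s1: "(of_int (s i) :: 'a) * of_int (s i) = 1" if "i < l" for i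
  proof -
    have "s i = 1 \<or> s i = -1" using bs that by (auto simp: orthonormal_def)
    then show ?thesis by auto
  qed
  have s_sub: "(of_int (s i) :: 'a) \<in> prime_subfield" if "i < l" for i
  proof -
    have "Tr (b i * b i) = of_int (s i)" using bs that by (simp add: orthonormal_def)
    then show ?thesis by (metis trace_in_prime_subfield)
  qed
  \<comment> \<open>Orthogonal projection onto the span: the norm of \<open>b j\<close> is a sign,
    hence its own inverse, so dividing by it is multiplying by \<open>s j\<close>.\<close>
  define proj where "proj x = (\<Sum>j<l. (of_int (s j) * Tr (x * b j)) * b j)" for x
  have perp: "Tr ((x - proj x) * b i) = 0" if "i < l" for x i
    using orthonormal_coefficient[OF bs, of "\<lambda>j. of_int (s j) * Tr (x * b j)" i] that s1[of i]
    by (simp add: proj_def left_diff_distrib trace_diff prime_subfield_mult s_sub mult.assoc mult.left_commute)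
  have isotropic: "Tr (y * y) = 0" if y: "\<And>i. i < l \<Longrightarrow> Tr (y * b i) = 0" for y
  proof (rule ccontr)
    define d where "d = Tr (y * y)"
    assume "Tr (y * y) \<noteq> 0"
    then have d: "d \<noteq> 0" "d \<in> prime_subfield" by (auto simp: d_def)
    \<comment> \<open>As \<open>-1\<close> is not a square in the prime field, \<open>y\<close> can be rescaled so that \<open>Tr (y\<^sup>2)\<close> is \<open>1\<close> or \<open>-1\<close>.\<close>
    define e where "e = d ^ ((p + 1) div 4)"
    have e: "e \<in> prime_subfield" "e \<noteq> 0" by (simp_all add: e_def d prime_subfield_power)
    have "e\<^sup>2 = d \<or> e\<^sup>2 = - d"
      unfolding e_def by (rule square_or_minus_square) (use d p_mod_4[OF q] prime_subfield_iff in auto)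
    then have "d = of_int 1 * e\<^sup>2 \<or> d = of_int (-1) * e\<^sup>2" by auto
    then obtain u :: int where u: "\<bar>u\<bar> = 1" "d = of_int u * e\<^sup>2"
      using that[of 1] that[of "-1"] by auto
    define w where "w = inverse e * y"
    have "Tr (w * w) = inverse e * (inverse e * d)"
    proof -
      have "w * w = inverse e * (inverse e * (y * y))" by (simp add: w_def mult_ac)
      then show ?thesis using e by (simp add: d_def trace_scale prime_subfield_inverse)
    qed
    then have ww: "Tr (w * w) = of_int u" using e(2) by (simp add: u(2) power2_eq_square field_simps)
    have wb: "Tr (w * b i) = 0" if "i < l" for i
      using e y[OF that] by (simp add: w_def mult.assoc trace_scale prime_subfield_inverse)
    then have bw: "Tr (b i * w) = 0" if "i < l" for i
      using that by (simp add: mult.commute)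
    have "orthonormal (Suc l) (b(l := w)) (s(l := u))"
      using bs u ww wb bw by (auto simp: orthonormal_def less_Suc_eq)
    with max show False by blast
  qed
  have proj: "x = proj x" for x
  proof -
    define y where "y = x - proj x"
    have y: "Tr (y * b i) = 0" if "i < l" for i using perp that by (simp add: y_def)
    have "Tr (y * z) = 0" for z
    proof -
      define v where "v = z - proj z"
      have v: "Tr (v * b i) = 0" if "i < l" for i using perp that by (simp add: v_def)
      \<comment> \<open>Polarisation: \<open>y\<close>, \<open>v\<close> and \<open>y + v\<close>
        are all isotropic and 2 is invertible, so \<open>Tr (y * v) = 0\<close>.\<close>
      have "Tr ((y + v) * (y + v)) = 0"
        by (rule isotropic) (simp add: distrib_right trace_add y v)
      moreover have "(y + v) * (y + v) = y * y + (y * v + y * v) + v * v"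
        by (simp add: distrib_left distrib_right mult.commute add_ac)
      ultimately have "Tr (y * v) + Tr (y * v) = 0"
        by (simp only: trace_add isotropic[OF y] isotropic[OF v] add_0 add_0_right)
      then have "2 * Tr (y * v) = 0" by (simp only: mult_2)
      then have "Tr (y * v) = 0" using two by simp
      moreover have "Tr (y * proj z) = 0"
      proof -
        have "Tr (y * proj z) = (\<Sum>j<l. Tr ((of_int (s j) * Tr (z * b j)) * (y * b j)))"
          by (simp add: proj_def sum_distrib_left trace_sum mult_ac)
        also have "\<dots> = 0"
          by (rule sum.neutral) (auto simp: trace_scale prime_subfield_mult s_sub y)
        finally show ?thesis .
      qed
      ultimately show ?thesis by (simp add: v_def right_diff_distrib trace_diff)
    qed
    then have "y = 0" by (rule trace_form_nondegenerate)
    then show ?thesis by (simp add: y_def)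
  qed
  have surj: "\<exists>c\<in>coefficient_vectors l. x = (\<Sum>j<l. of_nat (c j) * b j)" for x
  proof -
    have "\<exists>m<p. of_nat m = of_int (s j) * Tr (x * b j)" if "j < l" for j
      using prime_subfield_mult[OF s_sub[OF that] trace_in_prime_subfield, of "x * b j"]
      by (auto simp: prime_subfield_def)
    then obtain f where f: "\<And>j. j < l \<Longrightarrow> f j < p \<and> of_nat (f j) = of_int (s j) * Tr (x * b j)"
      by metis
    let ?c = "restrict f {..<l}"
    have "?c \<in> coefficient_vectors l" using f by auto
    moreover have "x = (\<Sum>j<l. of_nat (?c j) * b j)"
      by (subst proj[of x], unfold proj_def, rule sum.cong) (use f in auto)
    ultimately show ?thesis by blast
  qed
  have bij: "bij_betw (\<lambda>c. \<Sum>j<l. of_nat (c j) * b j) (coefficient_vectors l) UNIV"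
    unfolding bij_betw_def using inj_on_linear_combination[OF bs] surj by blast
  have "p ^ l = p ^ n"
    using bij_betw_same_card[OF bij] by (simp add: card_PiE card_UNIV)
  then have "l = n" using prime_p prime_gt_1_nat power_inject_exp by blast
  with bs bij that show ?thesis by blast
qed

lemma prod_orthonormal_signs:
  assumes q: "q mod 4 = 3" and orth: "orthonormal n b s"
  shows "(\<Prod>i<n. s i) = 1"
proof -
  \<comment> \<open>The matrix of conjugates: the product of the signs is the Gram determinant of the trace form,
    hence a square, while \<open>-1\<close> is not.\<close>
  define M where "M = mat n n (\<lambda>(i, j). b j ^ (p ^ i))"
  have M: "M \<in> carrier_mat n n" by (simp add: M_def)
  have gram: "M\<^sup>T * M = mat n n (\<lambda>(i, j). if i = j then of_int (s i) else 0)" (is "_ = ?D")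
  proof (rule eq_matI)
    fix i j assume "i < dim_row ?D" "j < dim_col ?D"
    then have ij: "i < n" "j < n" by auto
    then have "(M\<^sup>T * M) $$ (i, j) = (\<Sum>k<n. b i ^ (p ^ k) * b j ^ (p ^ k))"
      by (auto simp: M_def scalar_prod_def atLeast0LessThan intro!: sum.cong)
    also have "\<dots> = Tr (b i * b j)" by (simp add: field_trace_def power_mult_distrib)
    finally show "(M\<^sup>T * M) $$ (i, j) = ?D $$ (i, j)"
      using orth ij by (simp add: orthonormal_def)
  qed (auto simp: M_def)
  have "(det M)\<^sup>2 = det (M\<^sup>T * M)"
    using M by (subst det_mult[of _ n]) (auto simp: det_transpose power2_eq_square)
  also have "\<dots> = (\<Prod>i<n. of_int (s i))"
    unfolding gram by (subst det_upper_triangular[of _ n]) (auto simp: prod_list_diag_prod atLeast0LessThan)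
  finally have "of_int (\<Prod>i<n. s i) = (det M)\<^sup>2" by simp
  then have "of_int (\<Prod>i<n. s i) \<noteq> (-1 :: 'a)" using minus_1_not_square[OF q] by metis
  moreover have "\<bar>\<Prod>i<n. s i\<bar> = 1"
    using orth by (simp add: abs_prod orthonormal_def)
  then have "(\<Prod>i<n. s i) = 1 \<or> (\<Prod>i<n. s i) = -1" by linarith
  ultimately show ?thesis by (metis of_int_1 of_int_minus)
qed

lemma add_char_cong: "Tr x = Tr y \<Longrightarrow> add_char x = add_char y"
  using trace_in_prime_subfield[of x] by (auto simp: prime_subfield_def) (metis add_char_eq)

lemma norm_add_char [simp]: "norm (add_char x) = 1"
proof -
  obtain m where "Tr x = of_nat m"
    using trace_in_prime_subfield[of x] by (auto simp: prime_subfield_def)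
  then show ?thesis by (simp only: add_char_eq norm_power norm_cis power_one)
qed

lemma add_char_minus: "add_char (- x) = cnj (add_char x)"
proof -
  have "add_char (- x) * add_char x = 1" by (simp flip: add_char_add)
  moreover have "cnj (add_char x) * add_char x = 1"
    by (simp add: mult.commute complex_norm_square[symmetric])
  ultimately show ?thesis by (metis mult_right_cancel zero_neq_one mult_zero_right)
qed

lemma sum_add_char_squares:
  assumes q: "q mod 4 = 3"
  shows "\<exists>\<rho>>0. (\<Sum>x\<in>UNIV. add_char (x\<^sup>2)) = \<i> ^ n * complex_of_real \<rho>"
proof -
  obtain b s where orth: "orthonormal n b s"
    and bij: "bij_betw (\<lambda>c. \<Sum>j<n. of_nat (c j) * b j) (coefficient_vectors n) UNIV"
    using ex_complete_orthonormal[OF q] by blast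
  obtain \<rho> where \<rho>: "\<rho> > 0" "(\<Sum>j<p. cis (2 * pi / real p) ^ (j\<^sup>2)) = \<i> * complex_of_real \<rho>"
    using quadratic_exponential_sum[OF p_mod_4(1)[OF q]] by blast
  \<comment> \<open>Orthogonality removes the cross terms from the trace of the square.\<close>
  have split: "add_char ((\<Sum>j<n. of_nat (c j) * b j)\<^sup>2) = (\<Prod>j<n. add_char ((of_nat (c j) * b j)\<^sup>2))" for c
  proof -
    let ?x = "\<Sum>j<n. of_nat (c j) * b j"
    have "?x\<^sup>2 = (\<Sum>i<n. of_nat (c i) * (?x * b i))"
      by (simp add: power2_eq_square sum_distrib_left mult_ac)
    then have "Tr (?x\<^sup>2) = (\<Sum>i<n. of_nat (c i) * Tr (?x * b i))"
      by (simp add: trace_sum trace_scale)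
    also have "\<dots> = (\<Sum>i<n. of_nat (c i) * (of_nat (c i) * of_int (s i)))"
      by (intro sum.cong refl arg_cong2[where f = "(*)"] orthonormal_coefficient[OF orth]) auto
    also have "\<dots> = (\<Sum>i<n. Tr ((of_nat (c i) * b i)\<^sup>2))"
    proof (intro sum.cong refl)
      fix i assume "i \<in> {..<n}"
      then have "Tr (b i * b i) = of_int (s i)" using orth by (simp add: orthonormal_def)
      moreover have "(of_nat (c i) * b i)\<^sup>2 = of_nat (c i) * (of_nat (c i) * (b i * b i))"
        by (simp add: power2_eq_square)
      ultimately show "of_nat (c i) * (of_nat (c i) * of_int (s i)) = Tr ((of_nat (c i) * b i)\<^sup>2)"
        by (simp add: trace_scale)
    qed
    also have "\<dots> = Tr (\<Sum>i<n. (of_nat (c i) * b i)\<^sup>2)" by (simp add: trace_sum)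
    finally show ?thesis by (subst add_char_sum[symmetric]) (rule add_char_cong)
  qed
  have factor: "(\<Sum>k<p. add_char ((of_nat k * b j)\<^sup>2)) = \<i> * complex_of_real \<rho> * of_int (s j)"
    if j: "j < n" for j
  proof -
    have tr: "Tr ((of_nat k * b j)\<^sup>2) = of_nat (k\<^sup>2) * of_int (s j)" for k
    proof -
      have "Tr (b j * b j) = of_int (s j)" using orth j by (simp add: orthonormal_def)
      moreover have "(of_nat k * b j)\<^sup>2 = of_nat k * (of_nat k * (b j * b j))"
        by (simp add: power2_eq_square)
      ultimately show ?thesis by (simp add: trace_scale) (simp add: power2_eq_square)
    qed
    have "\<bar>s j\<bar> = 1" using orth j by (simp add: orthonormal_def)
    then consider "s j = 1" | "s j = -1" by linarith
    then show ?thesis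
    proof cases
      case 1
      then have "add_char ((of_nat k * b j)\<^sup>2) = cis (2 * pi / real p) ^ (k\<^sup>2)" for k
        by (intro add_char_eq) (simp only: tr of_int_1 mult_1_right)
      then show ?thesis using \<rho>(2) 1 by simp
    next
      \<comment> \<open>A negative sign conjugates the sum, and the conjugate of \<i> \<rho> is
        -\<i> \<rho>, which is the factor \<open>s j\<close>.\<close>
      case 2
      have "add_char ((of_nat k * b j)\<^sup>2) = cnj (cis (2 * pi / real p) ^ (k\<^sup>2))" for k
      proof -
        have "add_char (- ((of_nat k * b j)\<^sup>2)) = cis (2 * pi / real p) ^ (k\<^sup>2)"
          using trace_diff[of 0 "(of_nat k * b j)\<^sup>2"]
          by (intro add_char_eq) (simp only: tr 2, simp)
        then show ?thesis by (metis add_char_minus complex_cnj_cnj)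
      qed
      then have "(\<Sum>k<p. add_char ((of_nat k * b j)\<^sup>2)) = cnj (\<Sum>k<p. cis (2 * pi / real p) ^ (k\<^sup>2))"
        by (simp only: cnj_sum)
      then show ?thesis using \<rho>(2) 2 by simp
    qed
  qed
  have "(\<Sum>x\<in>UNIV. add_char (x\<^sup>2)) = (\<Sum>c\<in>coefficient_vectors n. \<Prod>j<n. add_char ((of_nat (c j) * b j)\<^sup>2))"
    by (subst sum.reindex_bij_betw[OF bij, symmetric]) (simp only: split)
  also have "\<dots> = (\<Prod>j<n. \<Sum>k<p. add_char ((of_nat k * b j)\<^sup>2))"
    by (rule prod_sum_PiE[symmetric]) auto
  also have "\<dots> = (\<Prod>j<n. \<i> * complex_of_real \<rho> * of_int (s j))"
    by (rule prod.cong) (auto simp: factor)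
  also have "\<dots> = (\<i> * complex_of_real \<rho>) ^ n * of_int (\<Prod>j<n. s j)"
    by (simp add: prod.distrib)
  also have "\<dots> = \<i> ^ n * complex_of_real (\<rho> ^ n)"
    by (simp add: prod_orthonormal_signs[OF q orth] power_mult_distrib)
  finally show ?thesis using \<rho>(1) by (intro exI[of _ "\<rho> ^ n"]) simp
qed

end

section \<open>Gauss and Jacobi sums\<close>

lemma mult_char_chpow:
  assumes "mult_char \<chi>"
  shows "mult_char (chpow \<chi> k)"
  using assms by (auto simp: mult_char_def chpow_def power_mult_distrib)

lemma chpow_mult_chpow: "chpow \<chi> i x * chpow \<chi> j x = chpow \<chi> (i + j) x"
  by (simp add: chpow_def power_add)

lemma mult_char_1:
  assumes "mult_char \<psi>"
  shows "\<psi> 1 = 1"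
proof -
  have "\<psi> 1 * \<psi> 1 = \<psi> 1" "\<psi> 1 \<noteq> 0"
    using assms unfolding mult_char_def by (metis mult_1, simp)
  then show ?thesis by simp
qed

lemma mult_char_power:
  assumes "mult_char \<psi>"
  shows "\<psi> (x ^ k) = \<psi> x ^ k"
  using assms mult_char_1[OF assms] by (induction k) (auto simp: mult_char_def)

lemma mult_char_prod:
  assumes "mult_char \<psi>"
  shows "\<psi> (\<Prod>i\<in>A. f i) = (\<Prod>i\<in>A. \<psi> (f i))"
  using assms mult_char_1[OF assms]
  by (induction A rule: infinite_finite_induct) (auto simp: mult_char_def)

lemma sum_nontrivial_mult_char:
  assumes \<psi>: "mult_char \<psi>" and y: "y \<noteq> 0" "\<psi> y \<noteq> 1"
  shows "(\<Sum>x\<in>UNIV. \<psi> x) = 0"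
proof -
  have "(\<Sum>x\<in>UNIV. \<psi> x) = (\<Sum>x\<in>UNIV. \<psi> (x * y))"
    by (rule sum.reindex_bij_witness[of _ "\<lambda>x. x * y" "\<lambda>x. x / y"]) (use y in auto)
  also have "\<dots> = (\<Sum>x\<in>UNIV. \<psi> x) * \<psi> y"
    using \<psi> by (simp add: mult_char_def sum_distrib_right)
  finally show ?thesis using y(2) by (metis mult_cancel_left1)
qed

text \<open>Substitute x = s y. Serves both the product of two Gauss sums and the action of B on
  character vectors.\<close>

lemma mult_char_convolution:
  assumes A: "mult_char A" and B: "mult_char B" and s: "s \<noteq> 0"
  shows "(\<Sum>x\<in>UNIV. A x * B (s - x)) = A s * B s * jacobi_sum A B"
proof -
  have "(\<Sum>x\<in>UNIV. A x * B (s - x)) = (\<Sum>y\<in>UNIV. A (s * y) * B (s * (1 - y)))"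
    by (rule sum.reindex_bij_witness[of _ "\<lambda>y. s * y" "\<lambda>x. x / s"])
      (use s in \<open>auto simp: right_diff_distrib\<close>)
  also have "\<dots> = A s * B s * jacobi_sum A B"
    using A B by (simp add: mult_char_def jacobi_sum_def sum_distrib_left mult_ac)
  finally show ?thesis .
qed

lemma jacobi_sum_commute: "jacobi_sum A B = jacobi_sum B A"
  unfolding jacobi_sum_def
  by (rule sum.reindex_bij_witness[of _ "\<lambda>x. 1 - x" "\<lambda>x. 1 - x"]) (auto simp: mult.commute)

text \<open>Collect the double sum by s = x + y. For s nonzero the inner sum is a Jacobi sum; s = 0
  yields the extra term, as B(-x) = B(-1) B(x).\<close>

lemma (in prime_power_field) gauss_sum_mult:
  fixes A B :: "'a \<Rightarrow> complex"
  assumes A: "mult_char A" and B: "mult_char B"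
  shows "gauss_sum p n A * gauss_sum p n B =
    jacobi_sum A B * gauss_sum p n (\<lambda>x. A x * B x) + B (-1) * (\<Sum>x\<in>UNIV. A x * B x)"
proof -
  have "gauss_sum p n A * gauss_sum p n B = (\<Sum>x\<in>UNIV. \<Sum>y\<in>UNIV. A x * B y * add_char (x + y))"
    by (simp add: gauss_sum_add_char sum_product add_char_add mult_ac)
  also have "\<dots> = (\<Sum>x\<in>UNIV. \<Sum>s\<in>UNIV. A x * B (s - x) * add_char s)"
  proof (rule sum.cong)
    fix x
    show "(\<Sum>y\<in>UNIV. A x * B y * add_char (x + y)) = (\<Sum>s\<in>UNIV. A x * B (s - x) * add_char s)"
      by (rule sum.reindex_bij_witness[of _ "\<lambda>s. s - x" "\<lambda>y. x + y"]) auto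
  qed simp
  also have "\<dots> = (\<Sum>s\<in>UNIV. (\<Sum>x\<in>UNIV. A x * B (s - x)) * add_char s)"
    by (subst sum.swap) (simp add: sum_distrib_right)
  also have "\<dots> = (\<Sum>x\<in>UNIV. A x * B (0 - x)) * add_char 0
      + (\<Sum>s\<in>UNIV - {0}. (\<Sum>x\<in>UNIV. A x * B (s - x)) * add_char s)"
    by (subst sum.remove[of UNIV 0]) auto
  also have "(\<Sum>x\<in>UNIV. A x * B (0 - x)) * add_char 0 = B (-1) * (\<Sum>x\<in>UNIV. A x * B x)"
  proof -
    have "A x * B (0 - x) = B (-1) * (A x * B x)" for x
      using B unfolding mult_char_def by (metis diff_0 mult_minus1 mult.left_commute)
    then show ?thesis by (simp only: add_char_0 mult_1_right sum_distrib_left)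
  qed
  also have "(\<Sum>s\<in>UNIV - {0}. (\<Sum>x\<in>UNIV. A x * B (s - x)) * add_char s)
      = (\<Sum>s\<in>UNIV - {0}. A s * B s * jacobi_sum A B * add_char s)"
    by (rule sum.cong) (simp_all add: mult_char_convolution[OF A B])
  also have "\<dots> = (\<Sum>s\<in>UNIV. A s * B s * jacobi_sum A B * add_char s)"
    by (rule sum.mono_neutral_left) (use A in \<open>auto simp: mult_char_def\<close>)
  also have "\<dots> = jacobi_sum A B * gauss_sum p n (\<lambda>x. A x * B x)"
    by (simp add: gauss_sum_add_char sum_distrib_left mult_ac)
  finally show ?thesis by (simp add: add.commute)
qed

section \<open>Powers of a generating character and their Gauss sums\<close>

locale character_generator = prime_power_field F p n q
  for F :: "'a::{field,finite} itself" and p n q :: nat +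
  fixes \<chi> :: "'a \<Rightarrow> complex"
  assumes odd_q: "odd q" and gen: "char_generator \<chi>"
begin

lemma mult_char_\<chi>: "mult_char \<chi>"
  using gen by (simp add: char_generator_def)

lemma mult_char_chpow_\<chi> [simp]: "mult_char (chpow \<chi> k)"
  by (rule mult_char_chpow[OF mult_char_\<chi>])

lemma \<chi>_mult: "\<chi> (x * y) = \<chi> x * \<chi> y"
  and \<chi>_0 [simp]: "\<chi> 0 = 0"
  and \<chi>_eq_0_iff [simp]: "\<chi> x = 0 \<longleftrightarrow> x = 0"
  using mult_char_\<chi> by (auto simp: mult_char_def)

lemma \<chi>_1 [simp]: "\<chi> 1 = 1"
  by (rule mult_char_1[OF mult_char_\<chi>])

lemma \<chi>_power: "\<chi> (x ^ k) = \<chi> x ^ k"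
  by (rule mult_char_power[OF mult_char_\<chi>])

lemma q_ge_3: "q \<ge> 3"
proof -
  have "q \<noteq> 0" "q \<noteq> 1" using q_eq n_pos prime_p by (auto simp: not_prime_1)
  then show ?thesis using odd_q by presburger
qed

lemma nonzero_power_q_minus_1: "(x :: 'a) \<noteq> 0 \<Longrightarrow> x ^ (q - 1) = 1"
  using nonzero_power_card_minus_1[of x] card_q by simp

lemma \<chi>_power_q_minus_1: "x \<noteq> 0 \<Longrightarrow> \<chi> x ^ (q - 1) = 1"
  by (metis \<chi>_power nonzero_power_q_minus_1 \<chi>_1)

definition primitive_root :: "'a \<Rightarrow> bool" where
  "primitive_root g \<longleftrightarrow> g \<noteq> 0 \<and> (\<forall>x. x \<noteq> 0 \<longrightarrow> (\<exists>k. x = g ^ k)) \<and> (\<forall>k. g ^ k = 1 \<longleftrightarrow> q - 1 dvd k)"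

text \<open>The powers g^k with k < q-1 cover all q-1 nonzero elements, so they are distinct, which
  gives the exact order of g.\<close>

lemma ex_primitive_root: "\<exists>g. primitive_root g"
proof -
  obtain g :: 'a where g: "g \<noteq> 0" "\<And>x. x \<noteq> 0 \<Longrightarrow> \<exists>k. x = g ^ k"
    using multiplicative_generator by blast
  have g1: "g ^ (q - 1) = 1" by (rule nonzero_power_q_minus_1[OF g(1)])
  have red: "g ^ k = g ^ (k mod (q - 1))" for k
    by (subst mult_div_mod_eq[of "q - 1" k, symmetric], subst power_add, subst power_mult)
      (simp only: g1 power_one mult_1)
  have "UNIV - {0} \<subseteq> (\<lambda>k. g ^ k) ` {..<q - 1}"
  proof
    fix x :: 'a assume "x \<in> UNIV - {0}"
    then obtain k where "x = g ^ (k mod (q - 1))" using g(2) red by blast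
    then show "x \<in> (\<lambda>k. g ^ k) ` {..<q - 1}" using q_ge_3 by auto
  qed
  then have "card (UNIV - {0 :: 'a}) \<le> card ((\<lambda>k. g ^ k) ` {..<q - 1})"
    by (intro card_mono) auto
  then have "q - 1 \<le> card ((\<lambda>k. g ^ k) ` {..<q - 1})" by (simp add: card_q)
  then have inj: "inj_on (\<lambda>k. g ^ k) {..<q - 1}"
    using card_image_le[of "{..<q - 1}" "\<lambda>k. g ^ k"] by (intro eq_card_imp_inj_on) auto
  have "g ^ k = 1 \<longleftrightarrow> q - 1 dvd k" for k
  proof
    assume "g ^ k = 1"
    then have "g ^ (k mod (q - 1)) = g ^ 0" using red[of k] by simp
    then have "k mod (q - 1) = 0" using inj_onD[OF inj] q_ge_3 by simp
    then show "q - 1 dvd k" by blast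
  next
    assume "q - 1 dvd k"
    then show "g ^ k = 1" using red[of k] by simp
  qed
  with g have "primitive_root g" by (simp add: primitive_root_def)
  then show ?thesis by blast
qed

text \<open>This is where the generator hypothesis enters. The character sending a primitive root to
  a complex number of exact order q-1 is faithful, and it is a power of \<chi>, so \<chi> is
  faithful too.\<close>

lemma \<chi>_faithful:
  assumes "x \<noteq> 0" "\<chi> x = 1"
  shows "x = 1"
proof -
  obtain g where "primitive_root g" using ex_primitive_root by blast
  then have g: "g \<noteq> 0" "\<And>x. x \<noteq> 0 \<Longrightarrow> \<exists>k. x = g ^ k" "\<And>k. g ^ k = 1 \<longleftrightarrow> q - 1 dvd k"
    unfolding primitive_root_def by blast+
  obtain lg where lg: "\<And>x. x \<noteq> 0 \<Longrightarrow> x = g ^ lg x"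
    using g(2) by metis
  define \<omega> where "\<omega> = cis (2 * pi / real (q - 1))"
  have \<omega>: "\<omega> ^ k = 1 \<longleftrightarrow> q - 1 dvd k" for k
    unfolding \<omega>_def by (rule cis_power_eq_1_iff) (use q_ge_3 in simp)
  \<comment> \<open>Built on a chosen discrete logarithm, which need not be additive;
    \<open>eq\<close> below shows that the powers of \<omega> depend only on the corresponding
    powers of g.\<close>
  define \<psi> where "\<psi> y = (if y = 0 then 0 else \<omega> ^ lg y)" for y
  have eq: "\<omega> ^ i = \<omega> ^ j" if "g ^ i = g ^ j" for i j
    using that
  proof (induction i j rule: linorder_wlog)
    case (le i j)
    then have "g ^ (i + (j - i)) = g ^ i" by simp
    then have "g ^ (j - i) = 1" using g(1) by (simp only: power_add) simp
    then have "\<omega> ^ (i + (j - i)) = \<omega> ^ i" using g(3) \<omega> by (simp only: power_add) simp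
    then show ?case using le by simp
  qed auto
  have "\<psi> (y * z) = \<psi> y * \<psi> z" for y z
  proof (cases "y = 0 \<or> z = 0")
    case False
    then have "g ^ lg (y * z) = g ^ (lg y + lg z)"
      by (simp add: power_add flip: lg)
    then have "\<omega> ^ lg (y * z) = \<omega> ^ (lg y + lg z)" by (rule eq)
    then show ?thesis using False by (simp add: \<psi>_def power_add)
  qed (auto simp: \<psi>_def)
  then have "mult_char \<psi>" by (auto simp: mult_char_def \<psi>_def \<omega>_def)
  then obtain j where "\<psi> = chpow \<chi> j" using gen by (auto simp: char_generator_def)
  then have "\<psi> x = 1" using assms by (simp add: chpow_def)
  then have "q - 1 dvd lg x" using assms(1) \<omega> by (simp add: \<psi>_def)
  then show ?thesis using lg[OF assms(1)] g(3) by metis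
qed

lemma \<chi>_minus_1: "\<chi> (-1) = -1"
proof -
  have "\<chi> (-1) * \<chi> (-1) = 1" by (simp flip: \<chi>_mult)
  moreover have "\<chi> (-1) \<noteq> 1" using \<chi>_faithful[of "-1"] minus_1_neq_1[OF odd_q] by auto
  ultimately show ?thesis using square_eq_1_iff by blast
qed

lemma chpow_minus_1: "chpow \<chi> k (-1) = (-1) ^ k"
  by (simp add: chpow_def \<chi>_minus_1)

lemma chpow_cong:
  assumes "[i = j] (mod (q - 1))"
  shows "chpow \<chi> i = chpow \<chi> j"
proof -
  have red: "\<chi> x ^ k = \<chi> x ^ (k mod (q - 1))" if "x \<noteq> 0" for x k
    by (subst mult_div_mod_eq[of "q - 1" k, symmetric], subst power_add, subst power_mult)
      (simp only: \<chi>_power_q_minus_1[OF that] power_one mult_1)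
  show ?thesis
  proof
    fix x
    show "chpow \<chi> i x = chpow \<chi> j x"
    proof (cases "x = 0")
      case False
      then show ?thesis
        using red[OF False, of i] red[OF False, of j] assms by (simp only: chpow_def cong_def if_False)
    qed (simp add: chpow_def)
  qed
qed

lemma chpow_trivial:
  assumes "q - 1 dvd k"
  shows "chpow \<chi> k x = (if x = 0 then 0 else 1)"
proof -
  have "chpow \<chi> k = chpow \<chi> 0" by (rule chpow_cong) (use assms in \<open>simp add: cong_0_iff\<close>)
  then show ?thesis by (simp add: chpow_def)
qed

lemma sum_chpow_nontrivial:
  assumes "\<not> q - 1 dvd k"
  shows "(\<Sum>x\<in>UNIV. chpow \<chi> k x) = 0"
proof -
  obtain g where "primitive_root g" using ex_primitive_root by blast
  then have g: "g \<noteq> 0" "\<And>k. g ^ k = 1 \<longleftrightarrow> q - 1 dvd k"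
    unfolding primitive_root_def by blast+
  have "g ^ k \<noteq> 1" "g ^ k \<noteq> 0" using g assms by auto
  then have "\<chi> (g ^ k) \<noteq> 1" using \<chi>_faithful by blast
  then have "chpow \<chi> k g \<noteq> 1" using g(1) by (simp add: chpow_def \<chi>_power)
  then show ?thesis using g(1) by (intro sum_nontrivial_mult_char[of _ g]) auto
qed

lemma sum_chpow_trivial:
  assumes "q - 1 dvd k"
  shows "(\<Sum>x\<in>UNIV. chpow \<chi> k x) = of_nat (q - 1)"
proof -
  have "(\<Sum>x\<in>UNIV. chpow \<chi> k x) = (\<Sum>x\<in>UNIV - {0}. chpow \<chi> k x)"
    by (rule sum.mono_neutral_right) (auto simp: chpow_def)
  also have "\<dots> = (\<Sum>x\<in>UNIV - {0 :: 'a}. 1)"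
    by (rule sum.cong) (auto simp: chpow_trivial[OF assms])
  also have "\<dots> = of_nat (q - 1)" by (simp add: card_q)
  finally show ?thesis .
qed

abbreviation G :: "nat \<Rightarrow> complex" where
  "G k \<equiv> gauss_sum p n (chpow \<chi> k)"

abbreviation J :: "nat \<Rightarrow> nat \<Rightarrow> complex" where
  "J i j \<equiv> jacobi_sum (chpow \<chi> i) (chpow \<chi> j)"

lemma G_cong: "[i = j] (mod (q - 1)) \<Longrightarrow> G i = G j"
  by (simp add: chpow_cong[of i j])

text \<open>Because the trivial character is 0 at 0, its Gauss sum is the full additive sum 0
  without the term 1 at the origin.\<close>

lemma G_trivial:
  assumes "q - 1 dvd k"
  shows "G k = -1"
proof -
  have "G k = (\<Sum>x\<in>UNIV - {0}. chpow \<chi> k x * add_char x)"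
    unfolding gauss_sum_add_char by (rule sum.mono_neutral_right) (auto simp: chpow_def)
  also have "\<dots> = (\<Sum>x\<in>UNIV - {0}. add_char x)"
    by (rule sum.cong) (auto simp: chpow_trivial[OF assms])
  also have "\<dots> = -1"
    using sum.remove[of UNIV "0 :: 'a" add_char] sum_add_char by (simp add: eq_neg_iff_add_eq_0 add.commute)
  finally show ?thesis .
qed

lemma G_mult: "\<not> q - 1 dvd i + j \<Longrightarrow> G i * G j = J i j * G (i + j)"
  using gauss_sum_mult[of "chpow \<chi> i" "chpow \<chi> j"]
  by (simp add: chpow_mult_chpow sum_chpow_nontrivial)

text \<open>With u = x/(1-x) the summand becomes \<chi>^i(u), as \<chi>^(i+j) is trivial, and u
  omits only 0 and -1. The full character sum vanishes, leaving minus the term at -1.\<close>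

lemma J_inverse:
  assumes ij: "q - 1 dvd i + j" and i: "\<not> q - 1 dvd i"
  shows "J i j = - ((-1) ^ i)"
proof -
  have "J i j = (\<Sum>x\<in>UNIV - {0, 1}. chpow \<chi> i x * chpow \<chi> j (1 - x))"
    unfolding jacobi_sum_def by (rule sum.mono_neutral_right) (auto simp: chpow_def)
  also have "\<dots> = (\<Sum>u\<in>UNIV - {0, -1}. chpow \<chi> i u)"
  proof (rule sum.reindex_bij_witness[of _ "\<lambda>u. u / (1 + u)" "\<lambda>x. x / (1 - x)"])
    fix x :: 'a assume x: "x \<in> UNIV - {0, 1}"
    then have x': "1 - x \<noteq> 0" by auto
    have one: "1 + x / (1 - x) = 1 / (1 - x)" using x' by (simp add: field_simps)
    then show "x / (1 - x) / (1 + x / (1 - x)) = x" using x' by simp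
    have "x / (1 - x) \<noteq> -1" using one x' by (metis add.right_inverse divide_eq_0_iff zero_neq_one)
    then show "x / (1 - x) \<in> UNIV - {0, -1}" using x x' by auto
    have "chpow \<chi> i x = chpow \<chi> i (x / (1 - x)) * chpow \<chi> i (1 - x)"
      using x' mult_char_chpow_\<chi>[of i] unfolding mult_char_def
      by (metis nonzero_divide_eq_eq)
    then have "chpow \<chi> i x * chpow \<chi> j (1 - x) = chpow \<chi> i (x / (1 - x)) * chpow \<chi> (i + j) (1 - x)"
      by (simp add: mult.assoc chpow_mult_chpow)
    then show "chpow \<chi> i (x / (1 - x)) = chpow \<chi> i x * chpow \<chi> j (1 - x)"
      using x' by (simp add: chpow_trivial[OF ij])
  next
    fix u :: 'a assume u: "u \<in> UNIV - {0, -1}"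
    then have u': "1 + u \<noteq> 0" by (metis DiffD2 add_eq_0_iff insertCI)
    have one: "1 - u / (1 + u) = 1 / (1 + u)" using u' by (simp add: field_simps)
    then show "u / (1 + u) / (1 - u / (1 + u)) = u" using u' by simp
    have "u / (1 + u) \<noteq> 1" using one u' by auto
    then show "u / (1 + u) \<in> UNIV - {0, 1}" using u u' by auto
  qed
  also have "\<dots> = (\<Sum>u\<in>UNIV. chpow \<chi> i u) - (\<Sum>u\<in>{0, -1}. chpow \<chi> i u)"
    by (rule sum_diff) auto
  also have "\<dots> = - ((-1) ^ i)"
    by (simp add: sum_chpow_nontrivial[OF i] chpow_minus_1) (simp add: chpow_def)
  finally show ?thesis .
qed

text \<open>In \<open>gauss_sum_mult\<close> the Jacobi term contributes (-1)^i and the extra term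
  (-1)^j (q-1); i and j have equal parity because q-1 is even.\<close>

lemma G_mult_inverse:
  assumes ij: "q - 1 dvd i + j" and i: "\<not> q - 1 dvd i"
  shows "G i * G j = (-1) ^ i * of_nat q"
proof -
  have "even (q - 1)" using odd_q by simp
  then have "even (i + j)" using ij dvd_trans by blast
  then have "(-1 :: complex) ^ j = (-1) ^ i" by (simp add: minus_one_power_iff)
  moreover have "G i * G j = J i j * G (i + j) + (-1) ^ j * of_nat (q - 1)"
    using gauss_sum_mult[of "chpow \<chi> i" "chpow \<chi> j"]
    by (simp only: mult_char_chpow_\<chi> chpow_mult_chpow sum_chpow_trivial[OF ij] chpow_minus_1)
  moreover have "(of_nat q :: complex) = of_nat (Suc (q - 1))" using q_ge_3 by simp
  then have "(of_nat q :: complex) = 1 + of_nat (q - 1)" by (simp only: of_nat_Suc add.commute)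
  ultimately show ?thesis
    by (simp only: J_inverse[OF ij i] G_trivial[OF ij] distrib_left) simp
qed

text \<open>For nontrivial exponents the product with the Gauss sum of the inverse character is q up
  to sign.\<close>

lemma G_nonzero: "G k \<noteq> 0"
proof (cases "q - 1 dvd k")
  case False
  define j where "j = q - 1 - k mod (q - 1)"
  have "k mod (q - 1) \<le> q - 1" using q_ge_3 by (simp add: order_less_imp_le)
  then have "k mod (q - 1) + j = q - 1" by (simp add: j_def)
  then have "(k + j) mod (q - 1) = (q - 1) mod (q - 1)" by (metis mod_add_left_eq)
  then have "[k + j = 0] (mod (q - 1))" by (simp add: cong_def)
  then have "G k * G j = (-1) ^ k * of_nat q"
    using False by (intro G_mult_inverse) (auto simp: cong_0_iff)
  then show ?thesis using q_ge_3 by auto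
qed (simp add: G_trivial)

end

section \<open>Products of Gauss and Jacobi sums over the even powers of the character\<close>

lemma prod_shift_periodic:
  fixes f :: "nat \<Rightarrow> 'b::comm_monoid_mult"
  assumes "\<And>m. f (m + N) = f m"
  shows "(\<Prod>m<N. f (m + a)) = (\<Prod>m<N. f m)"
proof (induction a)
  case (Suc a)
  show ?case
  proof (cases N)
    case (Suc M)
    have "(\<Prod>m<N. f (m + Suc a)) = (\<Prod>m<M. f (Suc m + a)) * f (a + N)"
      by (simp add: Suc add.commute)
    also have "f (a + N) = f (0 + a)" by (simp add: assms)
    also have "(\<Prod>m<M. f (Suc m + a)) * f (0 + a) = (\<Prod>m<Suc M. f (m + a))"
      by (subst prod.lessThan_Suc_shift) (simp add: mult.commute)
    finally show ?thesis using Suc.IH Suc by simp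
  qed simp
qed simp

text \<open>Pairs m with 2t+1-m, which leaves only m = 0; used to bring inverse characters
  together.\<close>

lemma prod_reflected_pairs:
  fixes f :: "nat \<Rightarrow> 'b::comm_monoid_mult"
  assumes "\<And>m. 1 \<le> m \<Longrightarrow> m \<le> t \<Longrightarrow> f m * f (2 * t + 1 - m) = c"
  shows "(\<Prod>m<2 * t + 1. f m) = f 0 * c ^ t"
proof -
  have "{..<2 * t + 1} = insert 0 ({1..t} \<union> {t + 1..2 * t})" by auto
  then have "(\<Prod>m<2 * t + 1. f m) = f 0 * ((\<Prod>m=1..t. f m) * (\<Prod>m=t + 1..2 * t. f m))"
    by (simp add: prod.union_disjoint)
  also have "(\<Prod>m=t + 1..2 * t. f m) = (\<Prod>m=1..t. f (2 * t + 1 - m))"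
    by (rule prod.reindex_bij_witness[of _ "\<lambda>m. 2 * t + 1 - m" "\<lambda>m. 2 * t + 1 - m"]) auto
  also have "(\<Prod>m=1..t. f m) * (\<Prod>m=1..t. f (2 * t + 1 - m)) = (\<Prod>m=1..t. c)"
    by (subst prod.distrib[symmetric], rule prod.cong) (use assms in auto)
  finally show ?thesis by simp
qed

lemma det_mat_diag: "det (mat_diag m f) = (\<Prod>i<m. f i)"
  by (subst det_upper_triangular[of _ m]) (auto simp: mat_diag_def prod_list_diag_prod atLeast0LessThan)

context character_generator
begin

text \<open>An element y has 1 + \<chi>^N(y) square roots, where N = (q-1)/2, so the Gauss sum
  equals the additive sum over squares. That sum supplies the phase, and the square of the Gauss sum
  supplies the modulus.\<close>

lemma gauss_sum_quadratic:
  assumes q: "q mod 4 = 3"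
  shows "G ((q - 1) div 2) = \<i> ^ n * complex_of_real (sqrt (real q))"
proof -
  define N where "N = (q - 1) div 2"
  have N: "odd N" "2 * N = q - 1" using q unfolding N_def by presburger+
  have odd_n: "odd n" by (rule p_mod_4(2)[OF q])
  have fibre: "of_nat (card {x. x\<^sup>2 = y}) = 1 + chpow \<chi> N y" for y
  proof (cases "y = 0")
    case True
    then have "{x. x\<^sup>2 = y} = {0}" by auto
    then show ?thesis using True by (simp add: chpow_def)
  next
    case False
    have "y ^ q = y" using power_card_eq_same[of y] card_q by simp
    then consider z where "y = z\<^sup>2" | z where "y = - (z\<^sup>2)"
      using square_or_minus_square[OF q _ False] by (metis minus_minus)
    then show ?thesis
    proof cases
      case 1
      then have z: "z \<noteq> 0" using False by auto
      have "z \<noteq> - z"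
      proof
        assume "z = - z"
        then have "-1 * z = 1 * z" by simp
        then show False using z minus_1_neq_1[OF odd_q] mult_right_cancel by blast
      qed
      moreover have "{x. x\<^sup>2 = y} = {z, - z}" using 1 by (auto simp: power2_eq_iff)
      ultimately have "card {x. x\<^sup>2 = y} = 2" by simp
      moreover have "chpow \<chi> N y = 1"
      proof -
        have "chpow \<chi> N y = \<chi> z ^ (2 * N)" using 1 z by (simp add: chpow_def \<chi>_power power_mult)
        then show ?thesis by (simp only: N(2) \<chi>_power_q_minus_1[OF z])
      qed
      ultimately show ?thesis by simp
    next
      case 2
      then have z: "z \<noteq> 0" using False by auto
      have "x\<^sup>2 \<noteq> y" for x
      proof
        assume "x\<^sup>2 = y"
        then have "(x / z)\<^sup>2 = -1" using 2 z by (simp add: power_divide)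
        then show False using minus_1_not_square[OF q] by blast
      qed
      then have "{x. x\<^sup>2 = y} = {}" by blast
      moreover have "chpow \<chi> N y = -1"
      proof -
        have "y = (-1) * z\<^sup>2" using 2 by simp
        then have "\<chi> y = (-1) * \<chi> z ^ 2" by (simp only: \<chi>_mult \<chi>_power \<chi>_minus_1)
        then have "chpow \<chi> N y = (-1) ^ N * \<chi> z ^ (2 * N)"
          using False by (simp only: chpow_def power_mult_distrib power_mult if_False)
        then show ?thesis using N(1) by (simp only: N(2) \<chi>_power_q_minus_1[OF z]) simp
      qed
      ultimately show ?thesis by simp
    qed
  qed
  have "(\<Sum>x\<in>UNIV. add_char (x\<^sup>2)) = (\<Sum>y\<in>UNIV. \<Sum>x\<in>{x \<in> UNIV. x\<^sup>2 = y}. add_char (x\<^sup>2))"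
    by (rule sum.group[symmetric]) auto
  also have "\<dots> = (\<Sum>y\<in>UNIV. of_nat (card {x. x\<^sup>2 = y}) * add_char y)"
    by (rule sum.cong) auto
  also have "\<dots> = (\<Sum>y\<in>UNIV. add_char y) + G N"
    by (simp add: fibre gauss_sum_add_char distrib_right sum.distrib)
  finally have "G N = (\<Sum>x\<in>UNIV. add_char (x\<^sup>2))" by (simp add: sum_add_char)
  then obtain \<rho> where \<rho>: "\<rho> > 0" "G N = \<i> ^ n * complex_of_real \<rho>"
    using sum_add_char_squares[OF q] by auto
  \<comment> \<open>The quadratic character is its own inverse and N is odd, so the square is -q; n
    is odd as well, hence \<rho>^2 = q.\<close>
  have "G N * G N = (-1) ^ N * of_nat q"
    by (rule G_mult_inverse) (use N q_ge_3 in \<open>auto simp: mult_2[symmetric] dest: dvd_imp_le\<close>)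
  then have "(\<i> ^ n * \<i> ^ n) * complex_of_real (\<rho> * \<rho>) = - of_nat q"
    using N(1) by (simp add: \<rho>(2) mult_ac)
  moreover have "\<i> ^ n * \<i> ^ n = -1"
    using odd_n by (simp flip: power_mult_distrib)
  ultimately have "complex_of_real (\<rho> * \<rho>) = complex_of_real (real q)" by simp
  then have "\<rho> * \<rho> = real q" by (simp only: of_real_eq_iff)
  then have "\<rho> = sqrt (real q)" using \<rho>(1) by (metis real_sqrt_mult_self abs_of_pos real_sqrt_abs2)
  then show ?thesis using \<rho>(2) by (simp add: N_def)
qed

lemma G_add_period: "G (k + (q - 1)) = G k"
  by (rule G_cong) (simp only: cong_def mod_add_self2)

text \<open>The exponents 2m and 2(2t+1-m) add up to q-1, so each of the t pairs gives q; m = 0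
  gives -1.\<close>

lemma prod_G_even:
  assumes t: "q = 4 * t + 3"
  shows "(\<Prod>m<2 * t + 1. G (2 * m)) = - (of_nat q ^ t)"
proof -
  have "(\<Prod>m<2 * t + 1. G (2 * m)) = G (2 * 0) * of_nat q ^ t"
  proof (rule prod_reflected_pairs)
    fix m assume m: "1 \<le> m" "m \<le> t"
    then have "2 * m + 2 * (2 * t + 1 - m) = q - 1" using t by simp
    moreover have "\<not> q - 1 dvd 2 * m" using m t by (auto dest!: dvd_imp_le)
    ultimately show "G (2 * m) * G (2 * (2 * t + 1 - m)) = of_nat q"
      using G_mult_inverse[of "2 * m" "2 * (2 * t + 1 - m)"] by simp
  qed
  then show ?thesis by (simp add: G_trivial)
qed

text \<open>Shifting by \<open>t\<close> puts the quadratic exponent 2t+1 = (q-1)/2 at m = 0. The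
  remaining exponents pair to 2(q-1) and are odd, so each pair gives -q.\<close>

lemma prod_G_odd:
  assumes t: "q = 4 * t + 3"
  shows "(\<Prod>m<2 * t + 1. G (2 * m + 1))
    = (-1) ^ t * of_nat q ^ t * (\<i> ^ n * complex_of_real (sqrt (real q)))"
proof -
  have per: "G (2 * (m + (2 * t + 1)) + 1) = G (2 * m + 1)" for m
    using G_add_period[of "2 * m + 1"] t by (simp add: algebra_simps)
  have "(\<Prod>m<2 * t + 1. G (2 * m + 1)) = (\<Prod>m<2 * t + 1. G (2 * (m + t) + 1))"
    using prod_shift_periodic[of "\<lambda>m. G (2 * m + 1)" "2 * t + 1" t] per by simp
  also have "\<dots> = G (2 * (0 + t) + 1) * (- of_nat q) ^ t"
  proof (rule prod_reflected_pairs)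
    fix m assume m: "1 \<le> m" "m \<le> t"
    then have "(2 * (m + t) + 1) + (2 * (2 * t + 1 - m + t) + 1) = 2 * (q - 1)" using t by simp
    then have "q - 1 dvd (2 * (m + t) + 1) + (2 * (2 * t + 1 - m + t) + 1)" by (metis dvd_triv_right)
    moreover have "\<not> q - 1 dvd 2 * (m + t) + 1"
    proof
      assume "q - 1 dvd 2 * (m + t) + 1"
      moreover have "2 dvd q - 1" using t by simp
      ultimately have "2 dvd 2 * (m + t) + 1" by (rule dvd_trans[rotated])
      then show False by simp
    qed
    ultimately show "G (2 * (m + t) + 1) * G (2 * (2 * t + 1 - m + t) + 1) = - of_nat q"
      using G_mult_inverse[of "2 * (m + t) + 1" "2 * (2 * t + 1 - m + t) + 1"] by simp
  qed
  also have "2 * (0 + t) + 1 = (q - 1) div 2" using t by simp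
  also have "G ((q - 1) div 2) = \<i> ^ n * complex_of_real (sqrt (real q))"
    by (rule gauss_sum_quadratic) (simp add: t)
  finally show ?thesis by (simp add: power_minus[of "of_nat q"] mult_ac)
qed

text \<open>r + 2m is odd and q-1 is even, so every Jacobi sum is a genuine quotient of Gauss sums.
  By periodicity the denominators run through all odd exponents, and the powers q^t cancel.\<close>

lemma prod_J_odd:
  assumes t: "q = 4 * t + 3" and r: "odd r"
  shows "(\<Prod>m<2 * t + 1. J r (2 * m))
    = (-1) ^ t * \<i> ^ n * G r ^ (2 * t + 1) / complex_of_real (sqrt (real q))"
proof -
  obtain a where a: "r = 2 * a + 1" using r by (elim oddE)
  have even_q: "2 dvd q - 1" using t by simp
  have per: "G (2 * (m + (2 * t + 1)) + 1) = G (2 * m + 1)" for m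
    using G_add_period[of "2 * m + 1"] t by (simp add: algebra_simps)
  have q0: "real q > 0" using t by simp
  have "(\<Prod>m<2 * t + 1. J r (2 * m)) * (\<Prod>m<2 * t + 1. G (2 * m + 1))
      = (\<Prod>m<2 * t + 1. J r (2 * m)) * (\<Prod>m<2 * t + 1. G (2 * (m + a) + 1))"
    using prod_shift_periodic[of "\<lambda>m. G (2 * m + 1)" "2 * t + 1" a] per by simp
  also have "\<dots> = (\<Prod>m<2 * t + 1. G r * G (2 * m))"
    unfolding prod.distrib[symmetric]
  proof (rule prod.cong)
    fix m
    have "odd (r + 2 * m)" using r by simp
    then have "\<not> q - 1 dvd r + 2 * m" using even_q dvd_trans by blast
    then have "G r * G (2 * m) = J r (2 * m) * G (r + 2 * m)" by (rule G_mult)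
    moreover have "2 * (m + a) + 1 = r + 2 * m" using a by simp
    ultimately show "J r (2 * m) * G (2 * (m + a) + 1) = G r * G (2 * m)"
      by (simp only:)
  qed simp
  also have "\<dots> = G r ^ (2 * t + 1) * - (of_nat q ^ t)"
    using prod_G_even[OF t] by (simp add: prod.distrib)
  finally have "(\<Prod>m<2 * t + 1. J r (2 * m)) * (\<Prod>m<2 * t + 1. G (2 * m + 1))
      = G r ^ (2 * t + 1) * - (of_nat q ^ t)" .
  from this[unfolded prod_G_odd[OF t]]
  have "(\<Prod>m<2 * t + 1. J r (2 * m)) * ((-1) ^ t * \<i> ^ n * complex_of_real (sqrt (real q))) * of_nat q ^ t
      = - (G r ^ (2 * t + 1)) * of_nat q ^ t"
    by (simp only: mult_ac mult_minus_right mult_minus_left)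
  then have eq: "(\<Prod>m<2 * t + 1. J r (2 * m)) * ((-1) ^ t * \<i> ^ n * complex_of_real (sqrt (real q)))
      = - (G r ^ (2 * t + 1))"
    using q0 by (metis mult_right_cancel of_nat_eq_0_iff of_nat_0 less_irrefl power_not_zero)
  have "odd n" by (rule p_mod_4(2)) (simp add: t)
  then have "\<i> ^ n * \<i> ^ n = -1" by (simp flip: power_mult_distrib)
  moreover have "(-1 :: complex) ^ t * (-1) ^ t = 1" by (simp flip: power_mult_distrib)
  ultimately have sq: "((-1) ^ t * \<i> ^ n) * ((-1) ^ t * \<i> ^ n) = (-1 :: complex)"
    by (metis (no_types, lifting) mult.assoc mult.left_commute mult_1)
  \<comment> \<open>Used with c = (-1)^t \<i>^n: as c^2 = -1, dividing by c and negating is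
    multiplying by c.\<close>
  have cancel: "P * s = c * X" if "P * (c * s) = - X" "c * c = -1" for P c s X :: complex
  proof -
    have "c * X = - (c * (P * (c * s)))" by (simp only: that(1) mult_minus_right minus_minus)
    also have "\<dots> = - (c * c) * (P * s)" by (simp add: mult_ac)
    finally show ?thesis by (simp only: that(2) minus_minus mult_1)
  qed
  have "(\<Prod>m<2 * t + 1. J r (2 * m)) * complex_of_real (sqrt (real q))
      = (-1) ^ t * \<i> ^ n * G r ^ (2 * t + 1)"
    by (rule cancel[OF eq sq])
  then show ?thesis using q0 by (simp add: divide_simps)
qed

text \<open>Numerators and denominators now run through the same even exponents and cancel. The one
  exception is r + 2m = q-1, where the Jacobi sum and the trivial Gauss sum are both -1 while G_r
  G_(2m) = q; this produces the factor 1/q.\<close>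

lemma prod_J_even:
  assumes t: "q = 4 * t + 3" and r: "even r" "1 \<le> r" "r \<le> q - 2"
  shows "(\<Prod>m<2 * t + 1. J r (2 * m)) = G r ^ (2 * t + 1) / of_nat q"
proof -
  obtain a where a: "r = 2 * a" using r by (elim evenE)
  let ?N = "2 * t + 1"
  have aN: "0 < a" "a < ?N" using a r t by auto
  have per: "G (2 * (m + ?N)) = G (2 * m)" for m
    using G_add_period[of "2 * m"] t by (simp add: algebra_simps)
  have "q \<noteq> 0" using t by simp
  then have q0: "(of_nat q :: complex) \<noteq> 0" by (simp only: of_nat_eq_0_iff not_False_eq_True)
  have "(\<Prod>m<?N. J r (2 * m)) * (\<Prod>m<?N. G (2 * m))
      = (\<Prod>m<?N. J r (2 * m) * G (2 * (m + a)))"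
    using prod_shift_periodic[of "\<lambda>m. G (2 * m)" ?N a] per by (simp add: prod.distrib)
  also have "\<dots> = (\<Prod>m<?N. G r * G (2 * m) * (if m = ?N - a then 1 / of_nat q else 1))"
  proof (rule prod.cong)
    fix m assume m: "m \<in> {..<?N}"
    have r2m: "2 * (m + a) = r + 2 * m" using a by simp
    show "J r (2 * m) * G (2 * (m + a)) = G r * G (2 * m) * (if m = ?N - a then 1 / of_nat q else 1)"
    proof (cases "m = ?N - a")
      case True
      then have "r + 2 * m = q - 1" using a aN t by simp
      then have dvd: "q - 1 dvd r + 2 * m" by simp
      have nd: "\<not> q - 1 dvd r" using r t by (auto dest!: dvd_imp_le)
      have "J r (2 * m) = -1" using J_inverse[OF dvd nd] r by simp
      moreover have "G (r + 2 * m) = -1" by (rule G_trivial[OF dvd])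
      moreover have "G r * G (2 * m) = of_nat q" using G_mult_inverse[OF dvd nd] r by simp
      ultimately show ?thesis unfolding r2m using True q0 by simp
    next
      case False
      have "\<not> q - 1 dvd r + 2 * m"
      proof
        assume "q - 1 dvd r + 2 * m"
        then obtain k where k: "r + 2 * m = (q - 1) * k" by blast
        then have k': "a + m = ?N * k" using a t by (simp add: algebra_simps)
        have "a + m < ?N * 2" "a + m \<noteq> 0" using aN m by auto
        then have "?N * k < ?N * 2" "k \<noteq> 0" unfolding k' by auto
        then have "k = 1" by (simp only: mult_less_cancel1) simp
        then show False using k' False by simp
      qed
      then show ?thesis unfolding r2m using G_mult[of r "2 * m"] False by simp
    qed
  qed simp
  also have "\<dots> = G r ^ ?N * (\<Prod>m<?N. G (2 * m)) * (1 / of_nat q)"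
  proof -
    have "(\<Prod>m<?N. if m = ?N - a then 1 / of_nat q else 1) = (1 / of_nat q :: complex)"
      by (subst prod.delta) (use aN in auto)
    then show ?thesis by (simp only: prod.distrib prod_constant card_lessThan)
  qed
  finally have "(\<Prod>m<?N. J r (2 * m)) * (\<Prod>m<?N. G (2 * m))
      = (G r ^ ?N / of_nat q) * (\<Prod>m<?N. G (2 * m))" by simp
  moreover have "(\<Prod>m<?N. G (2 * m)) \<noteq> 0" by (simp add: G_nonzero)
  ultimately show ?thesis by (metis mult_right_cancel)
qed

end

section \<open>The matrix B\<close>

lemma sum_list_index:
  assumes "distinct as"
  shows "(\<Sum>j<length as. f (as ! j)) = (\<Sum>d\<in>set as. f d)"
  using assms by (intro sum.reindex_bij_betw bij_betw_nth) auto

lemma prod_list_index: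
  assumes "distinct as"
  shows "(\<Prod>j<length as. f (as ! j)) = (\<Prod>d\<in>set as. f d)"
  using assms by (intro prod.reindex_bij_betw bij_betw_nth) auto

context character_generator
begin

section \<open>The squares and the determinant for q congruent to 3 modulo 4\<close>

abbreviation D :: "'a set" where
  "D \<equiv> kth_powers 2"

lemma mem_D_iff: "x \<in> D \<longleftrightarrow> x \<noteq> 0 \<and> (\<exists>y. x = y\<^sup>2)"
  by (auto simp: kth_powers_def)

lemma inverse_in_D: "x \<in> D \<Longrightarrow> inverse x \<in> D"
  by (metis mem_D_iff inverse_nonzero_iff_nonzero power_inverse)

lemma prod_in_D:
  assumes "\<And>i. i \<in> A \<Longrightarrow> f i \<in> D"
  shows "(\<Prod>i\<in>A. f i) \<in> D"
proof -
  have "1 \<in> D" unfolding mem_D_iff by (metis one_neq_zero power_one)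
  moreover have "x * y \<in> D" if "x \<in> D" "y \<in> D" for x y
    using that unfolding mem_D_iff by (metis mult_eq_0_iff power_mult_distrib)
  ultimately show ?thesis using assms
    by (induction A rule: infinite_finite_induct) auto
qed

context
  assumes q3: "q mod 4 = 3"
begin

lemma minus_not_in_D:
  assumes "x \<in> D"
  shows "- x \<notin> D"
proof
  assume "- x \<in> D"
  with assms obtain y z where yz: "x = y\<^sup>2" "- x = z\<^sup>2" "x \<noteq> 0" by (auto simp: mem_D_iff)
  then have "(z / y)\<^sup>2 = -1" by (auto simp: power_divide divide_eq_minus_1_iff)
  then show False using minus_1_not_square[OF q3] by blast
qed

lemma nonzero_eq_D_Un: "UNIV - {0} = D \<union> uminus ` D"
proof -
  have "x \<in> D \<or> x \<in> uminus ` D" if x: "x \<noteq> 0" for x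
  proof -
    have "x ^ q = x" using power_card_eq_same[of x] card_q by simp
    then obtain y where "y\<^sup>2 = x \<or> y\<^sup>2 = - x" using square_or_minus_square[OF q3 _ x] by blast
    then have "x \<in> D \<or> - x \<in> D" using x by (metis mem_D_iff neg_equal_0_iff_equal)
    then show ?thesis by (metis image_eqI minus_minus)
  qed
  moreover have "0 \<notin> D" "0 \<notin> uminus ` D" by (auto simp: mem_D_iff)
  ultimately show ?thesis by blast
qed

lemma D_disjoint: "D \<inter> uminus ` D = {}"
  using minus_not_in_D by auto

lemma card_D: "card D = (q - 1) div 2"
proof -
  have "card (UNIV - {0 :: 'a}) = card D + card (uminus ` D)"
    unfolding nonzero_eq_D_Un by (rule card_Un_disjoint) (use D_disjoint in auto)
  also have "card (uminus ` D) = card D" by (rule card_image) auto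
  finally show ?thesis by (simp add: card_q)
qed

text \<open>Inversion permutes the squares, so their product is 1 or -1; being itself a square, it
  is not -1.\<close>

lemma prod_D: "\<Prod>D = 1"
proof -
  have "\<Prod>D = (\<Prod>d\<in>D. inverse d)"
    by (rule prod.reindex_bij_witness[of _ inverse inverse]) (auto simp: inverse_in_D)
  then have "\<Prod>D = inverse (\<Prod>D)" using prod_inversef[of "\<lambda>d. d" D] by (simp add: o_def)
  moreover have PD: "\<Prod>D \<in> D" by (rule prod_in_D)
  ultimately have "\<Prod>D * \<Prod>D = 1" by (metis mem_D_iff right_inverse)
  then have "\<Prod>D = 1 \<or> \<Prod>D = -1" by (simp add: square_eq_1_iff)
  moreover have "\<Prod>D \<noteq> -1" using PD minus_1_not_square[OF q3] by (metis mem_D_iff)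
  ultimately show ?thesis by blast
qed

text \<open>\<chi>^(2m) is even, so the terms in a - d and a + d are the values at x = d and x = -d
  of one convolution summand, and D together with -D exhausts the nonzero x.\<close>

lemma sum_D_eigenvalue:
  assumes a: "a \<noteq> 0"
  shows "(\<Sum>d\<in>D. (chpow \<chi> r (a + d) + chpow \<chi> r (a - d)) * chpow \<chi> (2 * m) d)
    = chpow \<chi> r a * chpow \<chi> (2 * m) a * J r (2 * m)"
proof -
  let ?f = "\<lambda>x. chpow \<chi> (2 * m) x * chpow \<chi> r (a - x)"
  have even: "chpow \<chi> (2 * m) (- x) = chpow \<chi> (2 * m) x" for x
  proof -
    have "chpow \<chi> (2 * m) (-1 * x) = chpow \<chi> (2 * m) (-1) * chpow \<chi> (2 * m) x"
      using mult_char_chpow_\<chi> unfolding mult_char_def by blast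
    then show ?thesis by (simp add: chpow_minus_1)
  qed
  have "(x + y) * c = c * y + c * x" for x y c :: complex
    by (simp add: algebra_simps)
  then have "(\<Sum>d\<in>D. (chpow \<chi> r (a + d) + chpow \<chi> r (a - d)) * chpow \<chi> (2 * m) d)
      = (\<Sum>d\<in>D. ?f d) + (\<Sum>d\<in>D. ?f (- d))"
    unfolding even diff_minus_eq_add sum.distrib[symmetric] by (intro sum.cong refl)
  also have "(\<Sum>d\<in>D. ?f (- d)) = (\<Sum>x\<in>uminus ` D. ?f x)"
    by (subst sum.reindex) auto
  also have "(\<Sum>d\<in>D. ?f d) + (\<Sum>x\<in>uminus ` D. ?f x) = (\<Sum>x\<in>UNIV - {0}. ?f x)"
    unfolding nonzero_eq_D_Un by (rule sum.union_disjoint[symmetric]) (use D_disjoint in auto)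
  also have "\<dots> = (\<Sum>x\<in>UNIV. ?f x)"
    by (rule sum.mono_neutral_left) (auto simp: chpow_def)
  also have "\<dots> = chpow \<chi> (2 * m) a * chpow \<chi> r a * jacobi_sum (chpow \<chi> (2 * m)) (chpow \<chi> r)"
    by (rule mult_char_convolution) (use a in auto)
  also have "\<dots> = chpow \<chi> r a * chpow \<chi> (2 * m) a * J r (2 * m)"
    by (subst jacobi_sum_commute) (simp only: mult.commute)
  finally show ?thesis .
qed

text \<open>Orthogonality of characters: the product with the transposed matrix of inverses is N
  times the identity. Off the diagonal it is a geometric sum whose ratio \<chi>(x)^2 differs from 1,
  as x is neither 1 nor -1.\<close>

lemma det_character_matrix_nonzero:
  assumes as: "distinct as" "set as = D" and N: "N = length as"
  shows "det (mat N N (\<lambda>(j, m). chpow \<chi> (2 * m) (as ! j))) \<noteq> 0" (is "det ?V \<noteq> 0")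
proof -
  have N2: "2 * N = q - 1" "N > 0"
    using card_D distinct_card[OF as(1)] as(2) q3 unfolding N by (auto simp: mod_2_eq_odd)
      presburger+
  have asD: "as ! j \<in> D" "as ! j \<noteq> 0" if "j < N" for j
    using that as(2) N nth_mem[of j as] by (auto simp: mem_D_iff)
  define W where "W = mat N N (\<lambda>(m, j). inverse (chpow \<chi> (2 * m) (as ! j)))"
  have "?V * W = mat_diag N (\<lambda>_. of_nat N)"
  proof (rule eq_matI)
    fix i j assume "i < dim_row (mat_diag N (\<lambda>_. of_nat N :: complex))"
      "j < dim_col (mat_diag N (\<lambda>_. of_nat N :: complex))"
    then have ij: "i < N" "j < N" by (auto simp: mat_diag_def)
    define x where "x = as ! i / as ! j"
    have x0: "x \<noteq> 0" using asD ij by (simp add: x_def)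
    have "\<chi> (as ! i) = \<chi> x * \<chi> (as ! j)"
      using asD ij by (simp add: x_def flip: \<chi>_mult)
    then have quot: "chpow \<chi> (2 * m) (as ! i) * inverse (chpow \<chi> (2 * m) (as ! j)) = (\<chi> x ^ 2) ^ m" for m
      using asD ij by (simp add: chpow_def power_mult_distrib power_mult)
    have "(?V * W) $$ (i, j) = (\<Sum>m<N. (\<chi> x ^ 2) ^ m)"
      using ij by (simp add: W_def scalar_prod_def atLeast0LessThan quot)
    also have "\<dots> = (if i = j then of_nat N else 0)"
    proof (cases "i = j")
      case True
      then have "x = 1" using asD ij by (simp add: x_def)
      then show ?thesis using True by simp
    next
      case False
      have "\<chi> x ^ 2 \<noteq> 1"
      proof
        assume "\<chi> x ^ 2 = 1"
        then have "\<chi> (x\<^sup>2) = 1" by (simp add: \<chi>_power)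
        then have "x\<^sup>2 = 1" using x0 \<chi>_faithful[of "x\<^sup>2"] by simp
        then have "x = 1 \<or> x = -1" by (simp add: power2_eq_1_iff)
        then have "as ! i = as ! j \<or> as ! i = - (as ! j)"
          using asD ij by (auto simp: x_def divide_eq_minus_1_iff)
        then show False
          using False ij as(1) N nth_eq_iff_index_eq asD minus_not_in_D by metis
      qed
      moreover have "(\<chi> x ^ 2) ^ N = 1"
        using \<chi>_power_q_minus_1[OF x0] by (simp only: power_mult[symmetric] N2)
      ultimately show ?thesis using False by (simp add: sum_gp_strict)
    qed
    finally show "(?V * W) $$ (i, j) = mat_diag N (\<lambda>_. of_nat N) $$ (i, j)"
      using ij by (simp add: mat_diag_def)
  qed (auto simp: W_def mat_diag_def)
  then have "det ?V * det W = (of_nat N) ^ N"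
    by (subst det_mult[symmetric, of _ N]) (auto simp: W_def det_mat_diag)
  then show ?thesis using N2(2) by auto
qed

text \<open>With V the character matrix, B V is V multiplied on the left by the diagonal of the
  \<chi>^r(a_i) and on the right by that of the Jacobi sums. The left factor has determinant
  \<chi>^r of the product of the squares, which is 1, and det V cancels.\<close>

lemma det_Bmat_squares:
  assumes as: "distinct as" "set as = D"
  shows "det (Bmat (chpow \<chi> r) as) = (\<Prod>m<(q - 1) div 2. J r (2 * m))"
proof -
  define N where "N = length as"
  have N: "N = (q - 1) div 2" using card_D distinct_card[OF as(1)] as(2) by (simp add: N_def)
  have as0: "as ! j \<noteq> 0" if "j < N" for j
    using that as(2) nth_mem[of j as] by (auto simp: mem_D_iff N_def)
  define V where "V = mat N N (\<lambda>(j, m). chpow \<chi> (2 * m) (as ! j))"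
  have V: "V \<in> carrier_mat N N" by (simp add: V_def)
  let ?B = "Bmat (chpow \<chi> r) as"
  have B: "?B \<in> carrier_mat N N" by (simp add: Bmat_def N_def)
  have "?B * V = mat_diag N (\<lambda>i. chpow \<chi> r (as ! i)) * (V * mat_diag N (\<lambda>m. J r (2 * m)))"
  proof (rule eq_matI)
    fix i m
    assume "i < dim_row (mat_diag N (\<lambda>i. chpow \<chi> r (as ! i)) * (V * mat_diag N (\<lambda>m. J r (2 * m))))"
      "m < dim_col (mat_diag N (\<lambda>i. chpow \<chi> r (as ! i)) * (V * mat_diag N (\<lambda>m. J r (2 * m))))"
    then have im: "i < N" "m < N" by (auto simp: mat_diag_def)
    have "(?B * V) $$ (i, m) = (\<Sum>j<length as. (chpow \<chi> r (as ! i + as ! j) + chpow \<chi> r (as ! i - as ! j))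
        * chpow \<chi> (2 * m) (as ! j))"
      using im by (simp add: Bmat_def V_def scalar_prod_def atLeast0LessThan N_def)
    also have "\<dots> = chpow \<chi> r (as ! i) * chpow \<chi> (2 * m) (as ! i) * J r (2 * m)"
      by (subst sum_list_index[OF as(1)]) (simp add: as(2) sum_D_eigenvalue as0 im)
    also have "\<dots> = (mat_diag N (\<lambda>i. chpow \<chi> r (as ! i)) * (V * mat_diag N (\<lambda>m. J r (2 * m)))) $$ (i, m)"
    proof -
      have "mat_diag N f * mat N N h = mat N N (\<lambda>(i, j). f i * mat N N h $$ (i, j))"
        for f :: "nat \<Rightarrow> complex" and h
        by (rule mat_diag_mult_left) simp
      then show ?thesis
        unfolding mat_diag_mult_right[OF V] using im by (simp add: V_def mult.assoc)
    qed
    finally show "(?B * V) $$ (i, m) = \<dots>" .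
  qed (auto simp: Bmat_def V_def N_def mat_diag_def)
  then have "det ?B * det V = det (mat_diag N (\<lambda>i. chpow \<chi> r (as ! i))) * (det V * det (mat_diag N (\<lambda>m. J r (2 * m))))"
    using B V by (metis det_mult mat_diag_dim mult_carrier_mat)
  moreover have "det (mat_diag N (\<lambda>i. chpow \<chi> r (as ! i))) = 1"
  proof -
    have "det (mat_diag N (\<lambda>i. chpow \<chi> r (as ! i))) = (\<Prod>d\<in>D. chpow \<chi> r d)"
      using prod_list_index[OF as(1), of "chpow \<chi> r"] by (simp add: det_mat_diag N_def as(2))
    also have "\<dots> = chpow \<chi> r (\<Prod>D)" by (rule mult_char_prod[symmetric]) simp
    also have "\<dots> = 1" unfolding prod_D by (rule mult_char_1) simp
    finally show ?thesis .
  qed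
  moreover have "det V \<noteq> 0"
    unfolding V_def by (rule det_character_matrix_nonzero[OF as]) (simp add: N_def)
  ultimately show ?thesis by (simp add: det_mat_diag N mult.commute)
qed

end

section \<open>Singularity when the index (q-1)/k is even\<close>

lemma minus_1_in_kth_powers:
  assumes k: "k dvd q - 1" and ev: "even ((q - 1) div k)"
  shows "(-1 :: 'a) \<in> kth_powers k"
proof -
  obtain g where "primitive_root g" using ex_primitive_root by blast
  then have g: "g \<noteq> 0" "\<And>k. g ^ k = 1 \<longleftrightarrow> q - 1 dvd k"
    unfolding primitive_root_def by blast+
  \<comment> \<open>With q-1 = 2sk, the k-th power g^(sk) squares to 1 but is not 1, so it is
    -1.\<close>
  obtain s where "(q - 1) div k = 2 * s" using ev by blast
  then have s: "q - 1 = k * (2 * s)" using k by (metis dvd_mult_div_cancel)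
  have "s * k > 0" using s q_ge_3 by (intro Nat.gr0I) auto
  then have "\<not> q - 1 dvd s * k" using s by (auto dest!: dvd_imp_le)
  then have "g ^ (s * k) \<noteq> 1" using g(2) by blast
  moreover have "(g ^ (s * k))\<^sup>2 = 1" using g(2)[of "s * k * 2"] s by (simp add: power_mult mult_ac)
  ultimately have "(g ^ s) ^ k = -1" by (simp add: power2_eq_1_iff power_mult)
  moreover have "g ^ s \<noteq> 0" using g(1) by simp
  then have "(g ^ s) ^ k \<in> kth_powers k" unfolding kth_powers_def by blast
  ultimately show ?thesis by metis
qed

text \<open>Replacing a_j = 1 by -1 merely swaps the two summands of each entry, so these two
  columns agree.\<close>

lemma det_Bmat_even_index:
  assumes k: "k dvd q - 1" "even ((q - 1) div k)" and as: "distinct as" "set as = kth_powers k"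
  shows "det (Bmat (chpow \<chi> r) as) = 0"
proof -
  have "-1 \<in> set as" "1 \<in> set as"
    using minus_1_in_kth_powers[OF k] unfolding as(2) by (auto simp: kth_powers_def intro!: exI[of _ 1])
  then obtain i j where ij: "i < length as" "j < length as" "as ! i = -1" "as ! j = 1"
    by (metis in_set_conv_nth)
  have "i \<noteq> j" using ij minus_1_neq_1[OF odd_q] by auto
  then show ?thesis
    by (intro det_identical_columns[of _ "length as" i j])
      (use ij in \<open>auto simp: Bmat_def add.commute intro!: eq_vecI\<close>)
qed

end

theorem theorem1p1:
  fixes \<chi> :: "'a::{field,finite} \<Rightarrow> complex" and p n r :: nat
  assumes "prime p" and "n \<ge> 1" and "card (UNIV :: 'a set) = p ^ n" and "odd (card (UNIV :: 'a set))"
    and "char_generator \<chi>"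
    and "1 \<le> r" and "r \<le> card (UNIV :: 'a set) - 2"
  shows
    "(card (UNIV :: 'a set) mod 4 = 3 \<longrightarrow>
       (\<forall>as. distinct as \<and> set as = kth_powers 2 \<longrightarrow>
          det (Bmat (chpow \<chi> r) as)
            = (\<Prod>m = 0..(card (UNIV :: 'a set) - 3) div 2. jacobi_sum (chpow \<chi> r) (chpow \<chi> (2 * m)))
          \<and> (\<Prod>m = 0..(card (UNIV :: 'a set) - 3) div 2. jacobi_sum (chpow \<chi> r) (chpow \<chi> (2 * m)))
            = (if odd r
               then (-1) ^ ((card (UNIV :: 'a set) - 3) div 4) * \<i> ^ n
                      * gauss_sum p n (chpow \<chi> r) ^ ((card (UNIV :: 'a set) - 1) div 2)
                      / complex_of_real (sqrt (real (card (UNIV :: 'a set))))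
               else gauss_sum p n (chpow \<chi> r) ^ ((card (UNIV :: 'a set) - 1) div 2)
                      / of_nat (card (UNIV :: 'a set)))))
     \<and> (\<forall>k. k dvd card (UNIV :: 'a set) - 1 \<and> 1 < k \<and> k < card (UNIV :: 'a set) - 1
            \<and> even ((card (UNIV :: 'a set) - 1) div k) \<longrightarrow>
          (\<forall>as. distinct as \<and> set as = kth_powers k \<longrightarrow>
             det (Bmat (chpow \<chi> r) as) = 0))"
proof -
  define q where "q = card (UNIV :: 'a set)"
  interpret character_generator "TYPE('a)" p n q \<chi>
    by unfold_locales (use assms in \<open>auto simp: q_def\<close>)
  have one: "det (Bmat (chpow \<chi> r) as) = (\<Prod>m = 0..(q - 3) div 2. J r (2 * m))
      \<and> (\<Prod>m = 0..(q - 3) div 2. J r (2 * m))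
        = (if odd r then (-1) ^ ((q - 3) div 4) * \<i> ^ n * G r ^ ((q - 1) div 2) / complex_of_real (sqrt (real q))
           else G r ^ ((q - 1) div 2) / of_nat q)"
    if q3: "q mod 4 = 3" and as: "distinct as" "set as = kth_powers 2" for as
  proof -
    obtain t where t: "q = 4 * t + 3" using q3 by (metis mult_div_mod_eq)
    \<comment> \<open>The inclusive range up to (q-3)/2 = 2t consists of exactly 2t+1 = (q-1)/2
      indices.\<close>
    then have eqs: "(q - 3) div 4 = t" "(q - 1) div 2 = 2 * t + 1" "{0..(q - 3) div 2} = {..<2 * t + 1}"
      by auto
    have "1 \<le> r" "r \<le> q - 2" using assms by (simp_all add: q_def)
    then show ?thesis
      using det_Bmat_squares[OF q3 as, of r] prod_J_odd[OF t] prod_J_even[OF t]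
      by (auto simp only: eqs if_True if_False split: if_split)
  qed
  show ?thesis
    unfolding q_def[symmetric] using one det_Bmat_even_index by blast
qed

end
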